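(* Let $(M,S,g,\{\mathcal{L}_\alpha\})$ be a locally Lagrange space, with local Lagrangians $\mathcal{L}_\alpha$ on the sets $U_\alpha$ of an open covering of $M$. Then it is a globally Lagrange space if and only if both the first and the second Lagrangian obstructions exist and are equal to zero.
   Context: Everything is $C^\infty$. A tangent manifold $(M^{2n},S)$ is a manifold with $S\in\Gamma End(TM)$, $S^2=0$, $im\,S=ker\,S$ and vanishing Nijenhuis tensor; equivalently there is an atlas of adapted coordinates $(x^i,y^i)$ with $S(\partial/\partial x^i)=\partial/\partial y^i$, $S(\partial/\partial y^i)=0$. The vertical foliation $\mathcal{V}$ has $T\mathcal{V}=im\,S$, and $\nu\mathcal{V}=TM/T\mathcal{V}$. For a local function $\mathcal{L}$, $g_\mathcal{L}=Hess\,\mathcal{L}$ is the section of $\odot^2\nu^*\mathcal{V}$ with components $\partial^2\mathcal{L}/\partial y^i\partial y^j$ in adapted coordinates; $\mathcal{L}$ is a regular Lagrangian if $g_\mathcal{L}$ is non degenerate on $\nu\mathcal{V}$. A locally Lagrange space is a tangent manifold with a non degenerate $g\in\Gamma\odot^2\nu^*\mathcal{V}$, an open covering $M=\cup U_\alpha$ and regular $\mathcal{L}_\alpha\in C^\infty(U_\alpha)$ with $g|_{U_\alpha}=g_{\mathcal{L}_\alpha}$ for all $\alpha$. Sheaves on $M$: $\Phi$ = germs of foliated functions (locally functions of $x$ only); $\underline{A}^0$ = germs of locally leafwise affine functions (locally $\varphi_i(x)y^i+b(x)$); $\underline{\Omega}^{(1,0)}_{pr}$ = germs of foliated $1$-forms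 (locally $\varphi_i(x)dx^i$). There is an exact sequence $0\to\Phi\to\underline{A}^0\xrightarrow{\pi'}\underline{\Omega}^{(1,0)}_{pr}\to0$, where the first map is inclusion and $\pi'(\varphi_iy^i+b)=\varphi_idx^i$. The connecting homomorphism of its cohomology sequence is asserted to be zero in dimension $0$, so that one has the exact sequence $$0\to H^1(M,\Phi)\xrightarrow{\iota^*}H^1(M,\underline{A}^0)\xrightarrow{\pi^*}H^1(M,\underline{\Omega}^{(1,0)}_{pr})\xrightarrow{\partial}H^2(M,\Phi)\to\cdots,$$ where $\iota^*,\pi^*$ are induced by the inclusion and by $\pi'$. On $U_\alpha\cap U_\beta$ one has $\mathcal{L}_\beta-\mathcal{L}_\alpha\in\underline{A}^0(U_\alpha\cap U_\beta)$. The total Lagrangian obstruction $\mathcal{G}\in H^1(M,\underline{A}^0)$ is the class of the cocycle $\{\mathcal{L}_\beta-\mathcal{L}_\alpha\}$. The first Lagrangian obstruction is $\mathcal{G}_1=\pi^*(\mathcal{G})\in H^1(M,\underline{\Omega}^{(1,0)}_{pr})$. If $\mathcal{G}_1=0$, the second Lagrangian obstruction is the unique class $\mathcal{G}_2\in H^1(M,\Phi)$ such that $\iota^*(\mathcal{G}_2)=\mathcal{G}$, which exists and is unique by the exact sequence above; it is defined only when $\mathcal{G}_1=0$. The space is a globally Lagrange space if there is a global $\mathcal{L}\in C^\infty(M)$ with $\mathcal{L}|_{U_\alpha}-\mathcal{L}_\alpha\in\underline{A}^0(U_\alpha)$ for all $\alpha$.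
   Formalization: The connecting homomorphism need not vanish, so the second obstruction need not be unique; the unique-class version is stated when it vanishes, and in general the claim is that the first obstruction is zero and the zero class is a second obstruction (maps to the total one). *)

theory Defs
  imports "HOL-Analysis.Analysis" "HOL-Library.Function_Algebras"
begin

section \<open>Smooth manifolds of dimension 2n\<close>

text \<open>
  The manifold \<open>M\<close> is a Hausdorff, second countable type \<open>'m\<close>, and \<open>n = CARD('n)\<close>.
  A chart is a pair (domain, map) with values in \<open>\<real>\<^sup>n \<times> \<real>\<^sup>n\<close>; the values of the map
  outside the domain are irrelevant.
\<close>

type_synonym 'n model = "(real ^ 'n) \<times> (real ^ 'n)"
type_synonym ('m, 'n) chart = "'m set \<times> ('m \<Rightarrow> 'n model)"

primrec Ck_on :: "nat \<Rightarrow> 'a::real_normed_vector set \<Rightarrow> ('a \<Rightarrow> 'b::real_normed_vector) \<Rightarrow> bool"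
  where
    "Ck_on 0 D f \<longleftrightarrow> continuous_on D f"
  | "Ck_on (Suc k) D f \<longleftrightarrow> (\<forall>z\<in>D. f differentiable (at z)) \<and>
       (\<forall>v. Ck_on k D (\<lambda>z. frechet_derivative f (at z) v))"

text \<open>Only used for open sets \<open>D\<close>.\<close>

definition smooth_on :: "'a::real_normed_vector set \<Rightarrow> ('a \<Rightarrow> 'b::real_normed_vector) \<Rightarrow> bool"
  where "smooth_on D f \<longleftrightarrow> (\<forall>k. Ck_on k D f)"

abbreviation dom_chart :: "('m, 'n) chart \<Rightarrow> 'm set"
  where "dom_chart c \<equiv> fst c"

abbreviation coord :: "('m, 'n) chart \<Rightarrow> 'm \<Rightarrow> 'n model"
  where "coord c \<equiv> snd c"

definition chart_inv :: "('m, 'n) chart \<Rightarrow> 'n model \<Rightarrow> 'm"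
  where "chart_inv c = inv_into (dom_chart c) (coord c)"

definition is_chart :: "('m::topological_space, 'n::finite) chart \<Rightarrow> bool"
  where "is_chart c \<longleftrightarrow> open (dom_chart c) \<and> open (coord c ` dom_chart c) \<and>
    homeomorphism (dom_chart c) (coord c ` dom_chart c) (coord c) (chart_inv c)"

definition transition :: "('m, 'n) chart \<Rightarrow> ('m, 'n) chart \<Rightarrow> 'n model \<Rightarrow> 'n model"
  where "transition c d = (\<lambda>z. coord d (chart_inv c z))"

definition compatible :: "('m, 'n::finite) chart \<Rightarrow> ('m, 'n) chart \<Rightarrow> bool"
  where "compatible c d \<longleftrightarrow>
    smooth_on (coord c ` (dom_chart c \<inter> dom_chart d)) (transition c d) \<and>
    smooth_on (coord d ` (dom_chart c \<inter> dom_chart d)) (transition d c)"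

text \<open>A smooth structure is a maximal smooth atlas.\<close>

definition smooth_structure ::
    "('m::{t2_space, second_countable_topology}, 'n::finite) chart set \<Rightarrow> bool"
  where "smooth_structure A \<longleftrightarrow>
    (\<forall>c\<in>A. is_chart c) \<and>
    (\<Union>c\<in>A. dom_chart c) = UNIV \<and>
    (\<forall>c\<in>A. \<forall>d\<in>A. compatible c d) \<and>
    (\<forall>c. is_chart c \<and> (\<forall>d\<in>A. compatible c d) \<longrightarrow> c \<in> A)"

definition smooth_fun ::
    "('m, 'n::finite) chart set \<Rightarrow> 'm set \<Rightarrow> ('m \<Rightarrow> real) \<Rightarrow> bool"
  where "smooth_fun A W f \<longleftrightarrow>
    (\<forall>c\<in>A. smooth_on (coord c ` (dom_chart c \<inter> W)) (\<lambda>z. f (chart_inv c z)))"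

text \<open>Jacobian at \<open>p\<close> of the change of coordinates from \<open>c\<close> to \<open>d\<close>.\<close>

definition jac ::
    "('m, 'n::finite) chart \<Rightarrow> ('m, 'n) chart \<Rightarrow> 'm \<Rightarrow> 'n model \<Rightarrow> 'n model"
  where "jac c d p = frechet_derivative (transition c d) (at (coord c p))"

text \<open>Differential of \<open>f\<close> at \<open>p\<close>, read in the chart \<open>c\<close>.\<close>

definition dfun :: "('m \<Rightarrow> real) \<Rightarrow> 'm \<Rightarrow> ('m, 'n::finite) chart \<Rightarrow> 'n model \<Rightarrow> real"
  where "dfun f p c = frechet_derivative (\<lambda>z. f (chart_inv c z)) (at (coord c p))"


section \<open>Tangent manifolds\<close>

text \<open>
  Tensor fields are given at a point \<open>p\<close> by their expressions in all charts around \<open>p\<close>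
  (with respect to the frame of coordinate vector fields), related by the Jacobians.
\<close>

type_synonym ('m, 'n) endo_field = "'m \<Rightarrow> ('m, 'n) chart \<Rightarrow> 'n model \<Rightarrow> 'n model"
type_synonym ('m, 'n) bilin_field = "'m \<Rightarrow> ('m, 'n) chart \<Rightarrow> 'n model \<Rightarrow> 'n model \<Rightarrow> real"
type_synonym ('m, 'n) one_form = "'m \<Rightarrow> ('m, 'n) chart \<Rightarrow> 'n model \<Rightarrow> real"

definition smooth_endo_field ::
    "('m, 'n::finite) chart set \<Rightarrow> ('m, 'n) endo_field \<Rightarrow> bool"
  where "smooth_endo_field A S \<longleftrightarrow>
    (\<forall>c\<in>A. \<forall>p\<in>dom_chart c. linear (S p c)) \<and>
    (\<forall>c\<in>A. \<forall>v. smooth_on (coord c ` dom_chart c) (\<lambda>z. S (chart_inv c z) c v)) \<and>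
    (\<forall>c\<in>A. \<forall>d\<in>A. \<forall>p\<in>dom_chart c \<inter> dom_chart d. \<forall>v.
        S p d (jac c d p v) = jac c d p (S p c v))"

definition lie_bracket ::
    "('a::real_normed_vector \<Rightarrow> 'a) \<Rightarrow> ('a \<Rightarrow> 'a) \<Rightarrow> 'a \<Rightarrow> 'a"
  where "lie_bracket X Y = (\<lambda>z. frechet_derivative Y (at z) (X z) - frechet_derivative X (at z) (Y z))"

definition nijenhuis ::
    "('a::real_normed_vector \<Rightarrow> 'a \<Rightarrow> 'a) \<Rightarrow> ('a \<Rightarrow> 'a) \<Rightarrow> ('a \<Rightarrow> 'a) \<Rightarrow> 'a \<Rightarrow> 'a"
  where "nijenhuis T X Y = (\<lambda>z.
      lie_bracket (\<lambda>w. T w (X w)) (\<lambda>w. T w (Y w)) z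
    - T z (lie_bracket (\<lambda>w. T w (X w)) Y z)
    - T z (lie_bracket X (\<lambda>w. T w (Y w)) z)
    + T z (T z (lie_bracket X Y z)))"

text \<open>
  Adapted coordinates \<open>(x, y)\<close>: \<open>S(\<partial>/\<partial>x\<^sup>i) = \<partial>/\<partial>y\<^sup>i\<close> and \<open>S(\<partial>/\<partial>y\<^sup>i) = 0\<close>.
  Here \<open>x = fst (coord c p)\<close> and \<open>y = snd (coord c p)\<close>.
\<close>

definition adapted ::
    "('m, 'n::finite) chart set \<Rightarrow> ('m, 'n) endo_field \<Rightarrow> ('m, 'n) chart \<Rightarrow> bool"
  where "adapted A S c \<longleftrightarrow> c \<in> A \<and> (\<forall>p\<in>dom_chart c. \<forall>u w. S p c (u, w) = (0, u))"

text \<open>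
  The last two conditions below, vanishing of the Nijenhuis tensor and existence of an atlas of
  adapted charts, are equivalent given the others (integrability of almost tangent
  structures). Both are recorded because either one may be taken as the definition.
\<close>

definition tangent_manifold ::
    "('m::{t2_space, second_countable_topology}, 'n::finite) chart set
      \<Rightarrow> ('m, 'n) endo_field \<Rightarrow> bool"
  where "tangent_manifold A S \<longleftrightarrow>
    smooth_structure A \<and> smooth_endo_field A S \<and>
    (\<forall>c\<in>A. \<forall>p\<in>dom_chart c.
        (\<forall>v. S p c (S p c v) = 0) \<and> range (S p c) = {v. S p c v = 0}) \<and>
    (\<forall>c\<in>A. \<forall>X Y. smooth_on (coord c ` dom_chart c) X \<and> smooth_on (coord c ` dom_chart c) Y \<longrightarrow>
        (\<forall>z\<in>coord c ` dom_chart c. nijenhuis (\<lambda>z. S (chart_inv c z) c) X Y z = 0)) \<and>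
    (\<forall>p. \<exists>c. adapted A S c \<and> p \<in> dom_chart c)"


section \<open>Lagrangians\<close>

text \<open>The matrix \<open>\<partial>\<^sup>2L/\<partial>y\<^sup>i\<partial>y\<^sup>j\<close> at \<open>p\<close>, in the chart \<open>c\<close>.\<close>

definition hess :: "('m \<Rightarrow> real) \<Rightarrow> 'm \<Rightarrow> ('m, 'n::finite) chart \<Rightarrow> real ^ 'n ^ 'n"
  where "hess L p c = (\<chi> i j.
    frechet_derivative
      (\<lambda>z. frechet_derivative (\<lambda>w. L (chart_inv c w)) (at z) (0, axis j 1))
      (at (coord c p)) (0, axis i 1))"

definition regular_lagrangian ::
    "('m, 'n::finite) chart set \<Rightarrow> ('m, 'n) endo_field \<Rightarrow> 'm set \<Rightarrow> ('m \<Rightarrow> real) \<Rightarrow> bool"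
  where "regular_lagrangian A S W L \<longleftrightarrow> smooth_fun A W L \<and>
    (\<forall>c. adapted A S c \<longrightarrow> (\<forall>p\<in>dom_chart c \<inter> W. invertible (hess L p c)))"

text \<open>
  Sections of \<open>\<odot>\<^sup>2\<nu>\<^sup>*\<V>\<close> are the symmetric 2-covariant tensor fields annihilated by
  \<open>T\<V> = im S\<close>, i.e. those that descend to \<open>\<nu>\<V> = TM/T\<V>\<close>.
\<close>

definition transversal_form ::
    "('m, 'n::finite) chart set \<Rightarrow> ('m, 'n) endo_field \<Rightarrow> ('m, 'n) bilin_field \<Rightarrow> bool"
  where "transversal_form A S g \<longleftrightarrow>
    (\<forall>c\<in>A. \<forall>p\<in>dom_chart c. bilinear (g p c) \<and>
        (\<forall>u v. g p c u v = g p c v u) \<and> (\<forall>u v. g p c (S p c u) v = 0)) \<and>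
    (\<forall>c\<in>A. \<forall>u v. smooth_on (coord c ` dom_chart c) (\<lambda>z. g (chart_inv c z) c u v)) \<and>
    (\<forall>c\<in>A. \<forall>d\<in>A. \<forall>p\<in>dom_chart c \<inter> dom_chart d. \<forall>u v.
        g p d (jac c d p u) (jac c d p v) = g p c u v)"

definition nondegenerate_form ::
    "('m, 'n::finite) chart set \<Rightarrow> ('m, 'n) endo_field \<Rightarrow> ('m, 'n) bilin_field \<Rightarrow> bool"
  where "nondegenerate_form A S g \<longleftrightarrow>
    (\<forall>c\<in>A. \<forall>p\<in>dom_chart c. \<forall>u. (\<forall>v. g p c u v = 0) \<longrightarrow> u \<in> range (S p c))"

text \<open>Components \<open>g(\<partial>/\<partial>x\<^sup>i, \<partial>/\<partial>x\<^sup>j)\<close>.\<close>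

definition transversal_components ::
    "('m, 'n::finite) bilin_field \<Rightarrow> 'm \<Rightarrow> ('m, 'n) chart \<Rightarrow> real ^ 'n ^ 'n"
  where "transversal_components g p c = (\<chi> i j. g p c (axis i 1, 0) (axis j 1, 0))"

definition locally_lagrange_space ::
    "('m::{t2_space, second_countable_topology}, 'n::finite) chart set
      \<Rightarrow> ('m, 'n) endo_field \<Rightarrow> ('m, 'n) bilin_field
      \<Rightarrow> 'i set \<Rightarrow> ('i \<Rightarrow> 'm set) \<Rightarrow> ('i \<Rightarrow> 'm \<Rightarrow> real) \<Rightarrow> bool"
  where "locally_lagrange_space A S g I U L \<longleftrightarrow>
    tangent_manifold A S \<and> transversal_form A S g \<and> nondegenerate_form A S g \<and>
    (\<forall>\<alpha>\<in>I. open (U \<alpha>)) \<and> (\<Union>\<alpha>\<in>I. U \<alpha>) = UNIV \<and>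
    (\<forall>\<alpha>\<in>I. regular_lagrangian A S (U \<alpha>) (L \<alpha>)) \<and>
    (\<forall>\<alpha>\<in>I. \<forall>c. adapted A S c \<longrightarrow>
        (\<forall>p\<in>dom_chart c \<inter> U \<alpha>. transversal_components g p c = hess (L \<alpha>) p c))"


section \<open>The three sheaves\<close>

text \<open>
  A section over an open set \<open>W\<close> is represented by a total function on \<open>'m\<close>, of which only
  the values on \<open>W\<close> matter. The local expressions are required in all adapted charts; the
  form of the expressions is preserved by changes of adapted coordinates. In these expressions
  the coefficients \<open>h\<close> and \<open>b\<close> are automatically smooth near the point, since \<open>f\<close>, resp.
  \<open>\<omega>\<close>, is.
\<close>

definition foliated_fun ::
    "('m::topological_space, 'n::finite) chart set \<Rightarrow> ('m, 'n) endo_field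
      \<Rightarrow> 'm set \<Rightarrow> ('m \<Rightarrow> real) set"
  where "foliated_fun A S W = {f. smooth_fun A W f \<and>
    (\<forall>c. adapted A S c \<longrightarrow> (\<forall>p\<in>dom_chart c \<inter> W.
      \<exists>N b. open N \<and> p \<in> N \<and> N \<subseteq> dom_chart c \<inter> W \<and>
        (\<forall>q\<in>N. f q = b (fst (coord c q)))))}"

definition leafwise_affine ::
    "('m::topological_space, 'n::finite) chart set \<Rightarrow> ('m, 'n) endo_field
      \<Rightarrow> 'm set \<Rightarrow> ('m \<Rightarrow> real) set"
  where "leafwise_affine A S W = {f. smooth_fun A W f \<and>
    (\<forall>c. adapted A S c \<longrightarrow> (\<forall>p\<in>dom_chart c \<inter> W.
      \<exists>N (h :: real ^ 'n \<Rightarrow> real ^ 'n) b. open N \<and> p \<in> N \<and> N \<subseteq> dom_chart c \<inter> W \<and>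
        (\<forall>q\<in>N. f q = (\<Sum>i\<in>UNIV. h (fst (coord c q)) $ i * snd (coord c q) $ i)
                      + b (fst (coord c q)))))}"

text \<open>
  A 1-form is normalised to be 0 in charts that do not contain the point, so that pointwise
  equality is equality of forms.
\<close>

definition one_form_on ::
    "('m, 'n::finite) chart set \<Rightarrow> 'm set \<Rightarrow> ('m, 'n) one_form \<Rightarrow> bool"
  where "one_form_on A W \<omega> \<longleftrightarrow>
    (\<forall>p\<in>W. \<forall>c. (c \<in> A \<and> p \<in> dom_chart c \<longrightarrow> linear (\<omega> p c)) \<and>
                (\<not> (c \<in> A \<and> p \<in> dom_chart c) \<longrightarrow> \<omega> p c = (\<lambda>v. 0))) \<and>
    (\<forall>c\<in>A. \<forall>v. smooth_on (coord c ` (dom_chart c \<inter> W)) (\<lambda>z. \<omega> (chart_inv c z) c v)) \<and>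
    (\<forall>c\<in>A. \<forall>d\<in>A. \<forall>p\<in>dom_chart c \<inter> dom_chart d \<inter> W. \<forall>v. \<omega> p d (jac c d p v) = \<omega> p c v)"

definition foliated_form ::
    "('m::topological_space, 'n::finite) chart set \<Rightarrow> ('m, 'n) endo_field
      \<Rightarrow> 'm set \<Rightarrow> ('m, 'n) one_form set"
  where "foliated_form A S W = {\<omega>. one_form_on A W \<omega> \<and>
    (\<forall>c. adapted A S c \<longrightarrow> (\<forall>p\<in>dom_chart c \<inter> W.
      \<exists>N (h :: real ^ 'n \<Rightarrow> real ^ 'n). open N \<and> p \<in> N \<and> N \<subseteq> dom_chart c \<inter> W \<and>
        (\<forall>q\<in>N. \<forall>u w. \<omega> q c (u, w) = (\<Sum>i\<in>UNIV. h (fst (coord c q)) $ i * u $ i))))}"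

text \<open>
  The projection \<open>\<pi>'\<close>, written without coordinates as \<open>f \<mapsto> df \<circ> S\<close>. The lemma
  \<open>proj_form_adapted\<close> shows that in adapted coordinates it is
  \<open>\<phi>\<^sub>i y\<^sup>i + b \<mapsto> \<phi>\<^sub>i dx\<^sup>i\<close>.
\<close>

definition proj_form ::
    "('m, 'n::finite) chart set \<Rightarrow> ('m, 'n) endo_field \<Rightarrow> ('m \<Rightarrow> real) \<Rightarrow> ('m, 'n) one_form"
  where "proj_form A S f = (\<lambda>p c v.
    if c \<in> A \<and> p \<in> dom_chart c then dfun f p c (S p c v) else 0)"

lemma proj_form_adapted:
  fixes A :: "('m::{t2_space, second_countable_topology}, 'n::finite) chart set"
    and h :: "real ^ 'n \<Rightarrow> real ^ 'n"
  assumes A: "smooth_structure A" and c: "adapted A S c" and f: "smooth_fun A W f"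
    and N: "open N" "p \<in> N" "N \<subseteq> dom_chart c \<inter> W"
    and eq: "\<And>q. q \<in> N \<Longrightarrow> f q = (\<Sum>i\<in>UNIV. h (fst (coord c q)) $ i * snd (coord c q) $ i)
                                   + b (fst (coord c q))"
  shows "proj_form A S f p c (u, w) = (\<Sum>i\<in>UNIV. h (fst (coord c p)) $ i * u $ i)"
proof -
  define F where "F = (\<lambda>z. f (chart_inv c z))"
  define z where "z = coord c p"
  have cA: "c \<in> A" and Sc: "\<And>q u w. q \<in> dom_chart c \<Longrightarrow> S q c (u, w) = (0, u)"
    using c by (auto simp: adapted_def)
  have ch: "is_chart c" using A cA by (auto simp: smooth_structure_def)
  have p: "p \<in> dom_chart c" "p \<in> W" using N by auto
  have hom: "homeomorphism (dom_chart c) (coord c ` dom_chart c) (coord c) (chart_inv c)"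
    and opn: "open (coord c ` dom_chart c)"
    using ch by (auto simp: is_chart_def)
  have inv1: "chart_inv c (coord c q) = q" if "q \<in> dom_chart c" for q
    using hom that by (auto simp: homeomorphism_def)
  have "openin (top_of_set (coord c ` dom_chart c)) (coord c ` N)"
    using homeomorphism_imp_open_map[OF hom, of N] N
    by (auto simp: open_subset)
  then have oN: "open (coord c ` N)" using opn openin_open_trans by blast
  have "Ck_on (Suc 0) (coord c ` (dom_chart c \<inter> W)) F"
    using f cA unfolding smooth_fun_def smooth_on_def F_def by blast
  then have "\<forall>z\<in>coord c ` (dom_chart c \<inter> W). F differentiable (at z)"
    unfolding Ck_on.simps by blast
  then have "F differentiable (at z)" using p by (auto simp: z_def)
  then have D: "(F has_derivative frechet_derivative F (at z)) (at z)"
    by (simp add: frechet_derivative_works)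
  define l where "l = (\<lambda>t::real. z + t *\<^sub>R (0, u))"
  have l0: "l 0 = z" by (simp add: l_def zero_prod_def[symmetric])
  have dl: "(l has_derivative (\<lambda>t. t *\<^sub>R (0, u))) (at 0)"
    unfolding l_def by (auto intro!: derivative_eq_intros)
  have D1: "((F \<circ> l) has_derivative (\<lambda>t. frechet_derivative F (at z) (t *\<^sub>R (0, u)))) (at 0)"
    using diff_chain_at[OF dl, of F "frechet_derivative F (at z)"] D l0 by (simp add: o_def)
  define k where "k = (\<lambda>t::real. (\<Sum>i\<in>UNIV. h (fst z) $ i * (snd z $ i + t * u $ i)) + b (fst z))"
  have D2: "(k has_derivative (\<lambda>t. \<Sum>i\<in>UNIV. h (fst z) $ i * (t * u $ i))) (at 0)"
    unfolding k_def by (auto intro!: derivative_eq_intros)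
  have "continuous (at 0) l" using dl has_derivative_continuous by blast
  then have "l \<midarrow>0\<rightarrow> z" using l0 by (simp add: continuous_at)
  moreover have "z \<in> coord c ` N" using N by (simp add: z_def)
  ultimately have ev: "\<forall>\<^sub>F t in at 0. l t \<in> coord c ` N"
    using oN topological_tendstoD by blast
  have val: "F (l t) = k t" if "l t \<in> coord c ` N" for t
  proof -
    from that obtain q where q: "q \<in> N" "l t = coord c q" by auto
    then have "F (l t) = f q" using inv1 N by (auto simp: F_def)
    also have "\<dots> = k t" using eq[OF q(1)] q(2)[symmetric]
      by (simp add: k_def l_def)
    finally show ?thesis .
  qed
  have "((F \<circ> l) has_derivative (\<lambda>t. \<Sum>i\<in>UNIV. h (fst z) $ i * (t * u $ i))) (at 0)"
  proof (rule has_derivative_transform_eventually[OF D2])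
    show "\<forall>\<^sub>F t in at 0. k t = (F \<circ> l) t"
      using ev by eventually_elim (simp add: val)
    show "k 0 = (F \<circ> l) 0" using val[of 0] \<open>z \<in> coord c ` N\<close> l0 by simp
  qed simp
  with D1 have "(\<lambda>t. frechet_derivative F (at z) (t *\<^sub>R (0, u)))
      = (\<lambda>t. \<Sum>i\<in>UNIV. h (fst z) $ i * (t * u $ i))"
    by (rule has_derivative_unique)
  from fun_cong[OF this, of 1]
  have "frechet_derivative F (at z) (0, u) = (\<Sum>i\<in>UNIV. h (fst z) $ i * u $ i)" by simp
  then show ?thesis using cA p
    by (simp add: proj_form_def dfun_def Sc F_def z_def)
qed


section \<open>First cohomology of a sheaf\<close>

text \<open>
  Cech cohomology as in Godement: the direct limit over the coverings \<open>(W\<^sub>x)\<close> indexed by the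
  points of the space, with \<open>x \<in> W\<^sub>x\<close>, ordered by \<open>W\<^sub>x \<subseteq> V\<^sub>x\<close> for all \<open>x\<close>. These are cofinal
  among all open coverings. \<open>F W\<close> is the set of (representatives of) sections over \<open>W\<close>.
\<close>

definition point_cover :: "('m::topological_space \<Rightarrow> 'm set) \<Rightarrow> bool"
  where "point_cover W \<longleftrightarrow> (\<forall>x. open (W x) \<and> x \<in> W x)"

type_synonym ('m, 'v) cochain1 = "('m \<Rightarrow> 'm set) \<times> ('m \<Rightarrow> 'm \<Rightarrow> 'm \<Rightarrow> 'v)"

definition cocycles1 ::
    "('m::topological_space set \<Rightarrow> ('m \<Rightarrow> 'v::ab_group_add) set) \<Rightarrow> ('m, 'v) cochain1 set"
  where "cocycles1 F = {(W, s). point_cover W \<and>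
    (\<forall>x y. s x y \<in> F (W x \<inter> W y)) \<and>
    (\<forall>x y z. \<forall>p\<in>W x \<inter> W y \<inter> W z. s x y p + s y z p = s x z p)}"

definition cohomologous ::
    "('m::topological_space set \<Rightarrow> ('m \<Rightarrow> 'v::ab_group_add) set)
      \<Rightarrow> (('m, 'v) cochain1 \<times> ('m, 'v) cochain1) set"
  where "cohomologous F = {((V, s), (W, t)). (V, s) \<in> cocycles1 F \<and> (W, t) \<in> cocycles1 F \<and>
    (\<exists>N a. point_cover N \<and> (\<forall>x. N x \<subseteq> V x \<inter> W x \<and> a x \<in> F (N x)) \<and>
      (\<forall>x y. \<forall>p\<in>N x \<inter> N y. t x y p - s x y p = a y p - a x p))}"

definition H1 ::
    "('m::topological_space set \<Rightarrow> ('m \<Rightarrow> 'v::ab_group_add) set) \<Rightarrow> ('m, 'v) cochain1 set set"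
  where "H1 F = cocycles1 F // cohomologous F"

definition H1_zero ::
    "('m::topological_space set \<Rightarrow> ('m \<Rightarrow> 'v::ab_group_add) set) \<Rightarrow> ('m, 'v) cochain1 set"
  where "H1_zero F = cohomologous F `` {(\<lambda>x. UNIV, \<lambda>x y p. 0)}"

text \<open>The map into \<open>H1 G\<close> induced by a sheaf homomorphism \<open>\<theta>\<close> with values in \<open>G\<close>.\<close>

definition H1_map ::
    "('m::topological_space set \<Rightarrow> ('m \<Rightarrow> 'w::ab_group_add) set)
      \<Rightarrow> (('m \<Rightarrow> 'v) \<Rightarrow> ('m \<Rightarrow> 'w)) \<Rightarrow> ('m, 'v) cochain1 set \<Rightarrow> ('m, 'w) cochain1 set"
  where "H1_map G \<theta> C = cohomologous G `` ((\<lambda>(W, s). (W, \<lambda>x y. \<theta> (s x y))) ` C)"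

text \<open>
  The class of a 1-cocycle \<open>s\<close> on an arbitrary open covering \<open>(U \<alpha>)\<close>, \<open>\<alpha> \<in> I\<close>: pull the cocycle
  back by a refinement map \<open>\<tau>\<close> from a point-indexed covering. The result does not depend
  on \<open>\<tau>\<close>, so all refinement maps are allowed here.
\<close>

definition cocycle_class ::
    "('m::topological_space set \<Rightarrow> ('m \<Rightarrow> 'v::ab_group_add) set)
      \<Rightarrow> 'i set \<Rightarrow> ('i \<Rightarrow> 'm set) \<Rightarrow> ('i \<Rightarrow> 'i \<Rightarrow> 'm \<Rightarrow> 'v) \<Rightarrow> ('m, 'v) cochain1 set"
  where "cocycle_class F I U s = cohomologous F ``
    {(\<lambda>x. U (\<tau> x), \<lambda>x y. s (\<tau> x) (\<tau> y)) | \<tau>. \<forall>x. \<tau> x \<in> I \<and> x \<in> U (\<tau> x)}"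

text \<open>
  The connecting homomorphism from \<open>H\<^sup>0\<close> of the sheaf of foliated forms to \<open>H\<^sup>1\<close> of the sheaf
  of foliated functions: lift \<open>\<omega>\<close> locally to leafwise affine functions \<open>a x\<close> and take the class
  of their differences.
\<close>

definition connecting ::
    "('m::topological_space, 'n::finite) chart set \<Rightarrow> ('m, 'n) endo_field
      \<Rightarrow> ('m, 'n) one_form \<Rightarrow> ('m, real) cochain1 set"
  where "connecting A S \<omega> = cohomologous (foliated_fun A S) ``
    {(W, \<lambda>x y p. a y p - a x p) | W a. point_cover W \<and>
      (\<forall>x. a x \<in> leafwise_affine A S (W x) \<and> (\<forall>p\<in>W x. proj_form A S (a x) p = \<omega> p))}"

definition connecting_vanishes ::
    "('m::topological_space, 'n::finite) chart set \<Rightarrow> ('m, 'n) endo_field \<Rightarrow> bool"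
  where "connecting_vanishes A S \<longleftrightarrow>
    (\<forall>\<omega>\<in>foliated_form A S UNIV. connecting A S \<omega> = H1_zero (foliated_fun A S))"


section \<open>Lagrangian obstructions\<close>

definition total_obstruction ::
    "('m::topological_space, 'n::finite) chart set \<Rightarrow> ('m, 'n) endo_field
      \<Rightarrow> 'i set \<Rightarrow> ('i \<Rightarrow> 'm set) \<Rightarrow> ('i \<Rightarrow> 'm \<Rightarrow> real) \<Rightarrow> ('m, real) cochain1 set"
  where "total_obstruction A S I U L =
    cocycle_class (leafwise_affine A S) I U (\<lambda>\<alpha> \<beta> p. L \<beta> p - L \<alpha> p)"

definition first_obstruction ::
    "('m::topological_space, 'n::finite) chart set \<Rightarrow> ('m, 'n) endo_field
      \<Rightarrow> 'i set \<Rightarrow> ('i \<Rightarrow> 'm set) \<Rightarrow> ('i \<Rightarrow> 'm \<Rightarrow> real)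
      \<Rightarrow> ('m, ('m, 'n) chart \<Rightarrow> 'n model \<Rightarrow> real) cochain1 set"
  where "first_obstruction A S I U L =
    H1_map (foliated_form A S) (proj_form A S) (total_obstruction A S I U L)"

text \<open>
  The second obstruction is only defined when the first one vanishes. It is unique if
  \<open>H1_map (leafwise_affine A S) id\<close> is injective on \<open>H1 (foliated_fun A S)\<close>, that is, if
  the connecting homomorphism vanishes. This is not automatic: on the torus
  \<open>\<real>\<^sup>2/\<int>\<^sup>2\<close> with \<open>S(\<partial>/\<partial>x) = \<partial>/\<partial>y\<close> the form \<open>dx\<close> does not come from a global leafwise affine
  function. Hence being a second obstruction is introduced as a predicate first.
\<close>

definition is_second_obstruction ::
    "('m::topological_space, 'n::finite) chart set \<Rightarrow> ('m, 'n) endo_field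
      \<Rightarrow> 'i set \<Rightarrow> ('i \<Rightarrow> 'm set) \<Rightarrow> ('i \<Rightarrow> 'm \<Rightarrow> real)
      \<Rightarrow> ('m, real) cochain1 set \<Rightarrow> bool"
  where "is_second_obstruction A S I U L C \<longleftrightarrow>
    first_obstruction A S I U L = H1_zero (foliated_form A S) \<and>
    C \<in> H1 (foliated_fun A S) \<and>
    H1_map (leafwise_affine A S) id C = total_obstruction A S I U L"

definition second_obstruction_exists ::
    "('m::topological_space, 'n::finite) chart set \<Rightarrow> ('m, 'n) endo_field
      \<Rightarrow> 'i set \<Rightarrow> ('i \<Rightarrow> 'm set) \<Rightarrow> ('i \<Rightarrow> 'm \<Rightarrow> real) \<Rightarrow> bool"
  where "second_obstruction_exists A S I U L \<longleftrightarrow> (\<exists>!C. is_second_obstruction A S I U L C)"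

definition second_obstruction ::
    "('m::topological_space, 'n::finite) chart set \<Rightarrow> ('m, 'n) endo_field
      \<Rightarrow> 'i set \<Rightarrow> ('i \<Rightarrow> 'm set) \<Rightarrow> ('i \<Rightarrow> 'm \<Rightarrow> real) \<Rightarrow> ('m, real) cochain1 set"
  where "second_obstruction A S I U L = (THE C. is_second_obstruction A S I U L C)"

definition globally_lagrange ::
    "('m::topological_space, 'n::finite) chart set \<Rightarrow> ('m, 'n) endo_field
      \<Rightarrow> 'i set \<Rightarrow> ('i \<Rightarrow> 'm set) \<Rightarrow> ('i \<Rightarrow> 'm \<Rightarrow> real) \<Rightarrow> bool"
  where "globally_lagrange A S I U L \<longleftrightarrow>
    (\<exists>K. smooth_fun A UNIV K \<and>
      (\<forall>\<alpha>\<in>I. (\<lambda>p. K p - L \<alpha> p) \<in> leafwise_affine A S (U \<alpha>)))"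

end

theory Submission
  imports Defs
begin

text \<open>
  Two Lagrangians with the same vertical Hessian differ by a function whose restriction to the
  leaves is affine, so the total obstruction is a class with values in the leafwise affine
  functions. A primitive \<open>a\<close> of its cocycle corrects the local Lagrangians to \<open>L - a\<close>, which glue to
  a global one; conversely a global Lagrangian \<open>K\<close> provides the primitive \<open>L - K\<close>. Hence the space is
  globally Lagrange iff the total obstruction vanishes. Since \<open>H\<^sup>1\<close> is functorial this is equivalent
  to \<open>0\<close> being a second obstruction, and the vanishing of the connecting homomorphism makes the
  second obstruction unique in that case.
\<close>

section \<open>Calculus of smooth maps\<close>

text \<open>What shapes the proof is that the inclusion of foliated into leafwise affine functions
  may have a kernel on cohomology: on the torus the form \<open>dx\<close> has no global leafwise
  affine lift, and its connecting class lies in that kernel. A second obstruction can therefore fail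
  to be unique. The pivot is the criterion that the zero class is one of the second obstructions: it
  is equivalent to having a global Lagrangian whatever the connecting homomorphism does, and the
  formulation with a unique class is deduced from it once that homomorphism vanishes. Sections are
  total functions of which only the values on an open set count, so pasting needs an explicit global
  function. Point-indexed coverings supply it: at the point \<open>p\<close> the global object
  (\<open>K\<close> or \<open>\<omega>\<close>) takes the value of the local object with index
  \<open>p\<close>, and the coboundary relation shows that any other index gives the same
  value.\<close>

lemma frechet_derivative_cong_open:
  assumes "open D" "z \<in> D" "\<And>w. w \<in> D \<Longrightarrow> f w = g w"
  shows "frechet_derivative f (at z) = frechet_derivative g (at z)"
proof -
  \<comment> \<open>\<open>frechet_derivative\<close> is a choice among all derivatives, so equality
    of the sets of candidates suffices and differentiability is not at issue.\<close>
  have "(f has_derivative f') (at z) \<longleftrightarrow> (g has_derivative f') (at z)" for f'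
    using has_derivative_transform_within_open[OF _ assms(1,2), of f f' UNIV g]
      has_derivative_transform_within_open[OF _ assms(1,2), of g f' UNIV f] assms(3) by auto
  then show ?thesis by (simp add: frechet_derivative_def)
qed

lemma differentiable_cong_open:
  assumes "open D" "z \<in> D" "\<And>w. w \<in> D \<Longrightarrow> f w = g w" "f differentiable (at z)"
  shows "g differentiable (at z)"
  using assms has_derivative_transform_within_open[OF _ assms(1,2), of f _ UNIV g]
  unfolding differentiable_def by blast

lemma frechet_derivative_diff:
  assumes "f differentiable (at z)" "g differentiable (at z)"
  shows "frechet_derivative (\<lambda>w. f w - g w) (at z) v
    = frechet_derivative f (at z) v - frechet_derivative g (at z) v"
proof -
  have "((\<lambda>w. f w - g w) has_derivative
      (\<lambda>v. frechet_derivative f (at z) v - frechet_derivative g (at z) v)) (at z)"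
    using assms by (intro has_derivative_diff) (auto simp: frechet_derivative_works)
  from frechet_derivative_at[OF this] show ?thesis by metis
qed

lemma Ck_on_subset: "Ck_on k D f \<Longrightarrow> E \<subseteq> D \<Longrightarrow> Ck_on k E f"
  by (induction k arbitrary: f) (auto intro: continuous_on_subset)

lemma Ck_on_cong:
  assumes "open D" "\<And>w. w \<in> D \<Longrightarrow> f w = g w" "Ck_on k D f"
  shows "Ck_on k D g"
  using assms(2,3)
proof (induction k arbitrary: f g)
  case 0
  then show ?case using continuous_on_cong[of D D f g] by simp
next
  case (Suc k)
  have "Ck_on k D (\<lambda>z. frechet_derivative g (at z) v)" for v
    using Suc.IH[of "\<lambda>z. frechet_derivative f (at z) v" "\<lambda>z. frechet_derivative g (at z) v"]
      frechet_derivative_cong_open[OF assms(1) _ Suc.prems(1)] Suc.prems(2) by simp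
  then show ?case
    using Suc.prems differentiable_cong_open[OF assms(1) _ Suc.prems(1)] by simp
qed

text \<open>Differentiability is tested at single points, and on an open \<open>E\<close> continuity
  on \<open>E\<close> is continuity at each of its points, so \<open>E\<close> may reach outside
  \<open>D\<close>. This gives the gluing axiom for smooth functions and forms.\<close>

lemma Ck_on_locally:
  assumes "\<And>z. z \<in> D \<Longrightarrow> \<exists>E. open E \<and> z \<in> E \<and> Ck_on k E f"
  shows "Ck_on k D f"
  using assms
proof (induction k arbitrary: f)
  case 0
  have "continuous (at z) f" if "z \<in> D" for z
    using 0[OF that] continuous_on_eq_continuous_at by auto
  then show ?case by (simp add: continuous_at_imp_continuous_on)
next
  case (Suc k)
  have *: "\<exists>E. open E \<and> z \<in> E \<and> f differentiable (at z)
      \<and> (\<forall>v. Ck_on k E (\<lambda>z. frechet_derivative f (at z) v))" if "z \<in> D" for z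
    using Suc.prems[OF that] by auto
  then have "Ck_on k D (\<lambda>z. frechet_derivative f (at z) v)" for v
    by (intro Suc.IH) blast
  with * show ?case by auto
qed

lemma Ck_on_const: "Ck_on k D (\<lambda>z. c)"
  by (induction k arbitrary: c) auto

lemma Ck_on_Suc: "Ck_on (Suc k) D f \<Longrightarrow> Ck_on k D f"
proof (induction k arbitrary: f)
  case 0
  then show ?case
    by (auto intro!: continuous_at_imp_continuous_on differentiable_imp_continuous_within)
next
  case (Suc k)
  then have "Ck_on k D (\<lambda>z. frechet_derivative f (at z) v)" for v
    by (subst (asm) Ck_on.simps(2)) blast
  with Suc.prems show ?case by simp
qed

text \<open>The sum rule identifies \<open>frechet_derivative\<close> only at points of
  \<open>D\<close>, while the recursion asks for the derivative as a function.
  \<open>Ck_on_cong\<close> bridges this, using that \<open>D\<close> is open.\<close>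

lemma Ck_on_add:
  assumes "open D" "Ck_on k D f" "Ck_on k D g"
  shows "Ck_on k D (\<lambda>z. f z + g z)"
  using assms(2,3)
proof (induction k arbitrary: f g)
  case 0
  then show ?case by (simp add: continuous_on_add)
next
  case (Suc k)
  have "Ck_on k D (\<lambda>z. frechet_derivative (\<lambda>w. f w + g w) (at z) v)" for v
  proof (rule Ck_on_cong[OF assms(1)])
    show "Ck_on k D (\<lambda>z. frechet_derivative f (at z) v + frechet_derivative g (at z) v)"
      using Suc by simp
    fix z assume z: "z \<in> D"
    have "((\<lambda>w. f w + g w) has_derivative
        (\<lambda>v. frechet_derivative f (at z) v + frechet_derivative g (at z) v)) (at z)"
      using Suc.prems z by (intro has_derivative_add) (auto simp: frechet_derivative_works[symmetric])
    from frechet_derivative_at[OF this]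
    show "frechet_derivative f (at z) v + frechet_derivative g (at z) v
        = frechet_derivative (\<lambda>w. f w + g w) (at z) v" by metis
  qed
  with Suc.prems show ?case by simp
qed

text \<open>One product rule for multiplication and inner product. The derivative is a sum of two
  terms of the same bilinear shape, so the induction closes once the undifferentiated factor is
  lowered from order \<open>Suc k\<close> to \<open>k\<close>.\<close>

lemma Ck_on_bounded_bilinear:
  assumes b: "bounded_bilinear b" and "open D" "Ck_on k D f" "Ck_on k D g"
  shows "Ck_on k D (\<lambda>z. b (f z) (g z))"
  using assms(3,4)
proof (induction k arbitrary: f g)
  case 0
  then show ?case by (simp add: bounded_bilinear.continuous_on[OF b])
next
  case (Suc k)
  have d: "((\<lambda>w. b (f w) (g w)) has_derivative
      (\<lambda>v. b (f z) (frechet_derivative g (at z) v) + b (frechet_derivative f (at z) v) (g z))) (at z)"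
    if "z \<in> D" for z
    using Suc.prems that by (intro bounded_bilinear.FDERIV[OF b]) (auto simp: frechet_derivative_works[symmetric])
  have "Ck_on k D (\<lambda>z. frechet_derivative (\<lambda>w. b (f w) (g w)) (at z) v)" for v
  proof (rule Ck_on_cong[OF assms(2)])
    show "Ck_on k D (\<lambda>z. b (f z) (frechet_derivative g (at z) v) + b (frechet_derivative f (at z) v) (g z))"
      using Suc by (intro Ck_on_add[OF assms(2)] Suc.IH Ck_on_Suc[of k D f] Ck_on_Suc[of k D g]) auto
    show "b (f z) (frechet_derivative g (at z) v) + b (frechet_derivative f (at z) v) (g z)
        = frechet_derivative (\<lambda>w. b (f w) (g w)) (at z) v" if "z \<in> D" for z
      using frechet_derivative_at[OF d[OF that]] by metis
  qed
  moreover have "\<forall>z\<in>D. (\<lambda>w. b (f w) (g w)) differentiable (at z)"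
    using d unfolding differentiable_def by blast
  ultimately show ?case by simp
qed

lemma smooth_on_subset: "smooth_on D f \<Longrightarrow> E \<subseteq> D \<Longrightarrow> smooth_on E f"
  unfolding smooth_on_def using Ck_on_subset[of _ D f E] by simp

lemma smooth_on_cong:
  "smooth_on D f \<Longrightarrow> open D \<Longrightarrow> (\<And>w. w \<in> D \<Longrightarrow> f w = g w) \<Longrightarrow> smooth_on D g"
  unfolding smooth_on_def using Ck_on_cong[of D f g] by simp

lemma smooth_on_locally:
  "(\<And>z. z \<in> D \<Longrightarrow> \<exists>E. open E \<and> z \<in> E \<and> smooth_on E f) \<Longrightarrow> smooth_on D f"
  unfolding smooth_on_def by (intro allI Ck_on_locally) blast

lemma smooth_on_const: "smooth_on D (\<lambda>z. c)"
  by (simp add: smooth_on_def Ck_on_const)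

lemma smooth_on_add:
  "open D \<Longrightarrow> smooth_on D f \<Longrightarrow> smooth_on D g \<Longrightarrow> smooth_on D (\<lambda>z. f z + g z)"
  by (simp add: smooth_on_def Ck_on_add)

lemma smooth_on_sum:
  "open D \<Longrightarrow> (\<And>i. i \<in> B \<Longrightarrow> smooth_on D (f i)) \<Longrightarrow> smooth_on D (\<lambda>z. \<Sum>i\<in>B. f i z)"
  by (induction B rule: infinite_finite_induct) (auto intro: smooth_on_const smooth_on_add)

lemma smooth_on_mult:
  fixes f g :: "'a::real_normed_vector \<Rightarrow> 'b::real_normed_algebra"
  shows "open D \<Longrightarrow> smooth_on D f \<Longrightarrow> smooth_on D g \<Longrightarrow> smooth_on D (\<lambda>z. f z * g z)"
  by (simp add: smooth_on_def Ck_on_bounded_bilinear[OF bounded_bilinear_mult])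

lemma smooth_on_inner:
  "open D \<Longrightarrow> smooth_on D f \<Longrightarrow> smooth_on D g \<Longrightarrow> smooth_on D (\<lambda>z. inner (f z) (g z))"
  by (simp add: smooth_on_def Ck_on_bounded_bilinear[OF bounded_bilinear_inner])

lemma smooth_on_diff:
  fixes f g :: "'a::real_normed_vector \<Rightarrow> real"
  assumes "open D" "smooth_on D f" "smooth_on D g"
  shows "smooth_on D (\<lambda>z. f z - g z)"
  using smooth_on_add[OF assms(1,2) smooth_on_mult[OF assms(1) smooth_on_const[of D "-1"] assms(3)]]
  by simp

lemma smooth_on_frechet_derivative:
  assumes "smooth_on D f"
  shows "smooth_on D (\<lambda>z. frechet_derivative f (at z) v)"
  unfolding smooth_on_def
proof
  fix k
  have "Ck_on (Suc k) D f" using assms by (auto simp: smooth_on_def)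
  then show "Ck_on k D (\<lambda>z. frechet_derivative f (at z) v)" by simp
qed

lemma smooth_on_imp_differentiable: "smooth_on D f \<Longrightarrow> z \<in> D \<Longrightarrow> f differentiable (at z)"
  unfolding smooth_on_def by (drule spec[of _ "Suc 0"]) simp

text \<open>\<open>Ck_on\<close> controls derivatives only in directions that do not depend on the
  point. Expanding \<open>X z\<close> in the basis reduces a moving direction to finitely many fixed
  ones with smooth coefficients.\<close>

lemma smooth_on_frechet_derivative_field:
  fixes f :: "'a::euclidean_space \<Rightarrow> real"
  assumes D: "open D" and f: "smooth_on D f" and X: "smooth_on D X"
  shows "smooth_on D (\<lambda>z. frechet_derivative f (at z) (X z))"
proof (rule smooth_on_cong[OF _ D])
  show "smooth_on D (\<lambda>z. \<Sum>b\<in>Basis. inner (X z) b * frechet_derivative f (at z) b)"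
    by (intro smooth_on_sum smooth_on_mult smooth_on_inner smooth_on_const
        smooth_on_frechet_derivative D f X)
  fix z assume "z \<in> D"
  then have l: "linear (frechet_derivative f (at z))"
    using linear_frechet_derivative smooth_on_imp_differentiable f by blast
  have "frechet_derivative f (at z) (X z)
      = frechet_derivative f (at z) (\<Sum>b\<in>Basis. inner (X z) b *\<^sub>R b)"
    by (simp add: euclidean_representation)
  also have "\<dots> = (\<Sum>b\<in>Basis. inner (X z) b * frechet_derivative f (at z) b)"
    by (simp add: linear_sum[OF l] linear_cmul[OF l])
  finally show "(\<Sum>b\<in>Basis. inner (X z) b * frechet_derivative f (at z) b)
      = frechet_derivative f (at z) (X z)" by simp
qed

section \<open>Functions with vanishing vertical Hessian\<close>

lemma linear_snd_expansion:
  fixes l :: "'n::finite model \<Rightarrow> real"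
  assumes "linear l"
  shows "l (0, v) = (\<Sum>i\<in>UNIV. l (0, axis i 1) * v $ i)"
proof -
  have e: "(0, v) = (\<Sum>i\<in>UNIV. v $ i *\<^sub>R (0 :: real ^ 'n, axis i (1::real)))"
    by (simp add: prod_eq_iff fst_sum snd_sum vec_eq_iff axis_def if_distrib cong: if_cong)
  show ?thesis
    by (subst e) (simp add: linear_sum[OF assms] linear_cmul[OF assms] mult.commute del: scaleR_Pair)
qed

text \<open>On a product of an open set in \<open>x\<close> and a ball in \<open>y\<close>, every
  slice with fixed \<open>x\<close> is convex, so a vanishing derivative in \<open>y\<close> forces
  constancy there. This is applied to the partial derivatives in \<open>y\<close>, and again to
  \<open>f\<close> minus its linear part.\<close>

lemma leafwise_affine_if_zero_hessian:
  fixes f :: "'n::finite model \<Rightarrow> real"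
  assumes D: "open D" "p \<in> D" and f: "smooth_on D f"
    and hess: "\<And>z i j. z \<in> D \<Longrightarrow>
      frechet_derivative (\<lambda>z. frechet_derivative f (at z) (0, axis j 1)) (at z) (0, axis i 1) = 0"
  shows "\<exists>N (h :: real ^ 'n \<Rightarrow> real ^ 'n) b. open N \<and> p \<in> N \<and> N \<subseteq> D \<and>
    (\<forall>z\<in>N. f z = (\<Sum>i\<in>UNIV. h (fst z) $ i * snd z $ i) + b (fst z))"
proof -
  obtain B1 B2 where B: "open B1" "open B2" "p \<in> B1 \<times> B2" "B1 \<times> B2 \<subseteq> D"
    using open_prod_elim[OF D] by metis
  define y0 where "y0 = snd p"
  obtain r where r: "r > 0" "ball y0 r \<subseteq> B2"
    using B openE[OF B(2), of y0] by (auto simp: y0_def mem_Times_iff)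
  define G where "G = (\<lambda>j z. frechet_derivative f (at z) (0, axis j 1))"
  \<comment> \<open>The coefficients are sampled at the height \<open>y0\<close> of the base point;
    \<open>b\<close> is what makes the affine formula true at \<open>y = y0\<close>.\<close>
  define h :: "real ^ 'n \<Rightarrow> real ^ 'n" where "h = (\<lambda>x. \<chi> j. G j (x, y0))"
  define b where "b = (\<lambda>x. f (x, y0) - (\<Sum>i\<in>UNIV. h x $ i * y0 $ i))"
  have slice: "((\<lambda>y. F (x, y)) has_derivative (\<lambda>v. \<Sum>i\<in>UNIV. frechet_derivative F (at (x, y)) (0, axis i 1) * v $ i)) (at y within ball y0 r)"
    if "smooth_on D F" "x \<in> B1" "y \<in> ball y0 r" for F :: "'n model \<Rightarrow> real" and x y
  proof -
    have "(x, y) \<in> D" using that B r by auto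
    then have d: "F differentiable (at (x, y))" using smooth_on_imp_differentiable that by blast
    then have 1: "(F has_derivative frechet_derivative F (at (x, y))) (at (x, y))"
      by (simp add: frechet_derivative_works)
    have "((\<lambda>y. (x, y)) has_derivative (\<lambda>v. (0, v))) (at y)"
      by (auto intro!: derivative_eq_intros)
    from diff_chain_at[OF this 1]
    have 2: "((\<lambda>y. F (x, y)) has_derivative (\<lambda>v. frechet_derivative F (at (x, y)) (0, v))) (at y)"
      by (simp add: o_def)
    have 3: "(\<lambda>v. frechet_derivative F (at (x, y)) (0, v))
        = (\<lambda>v. \<Sum>i\<in>UNIV. frechet_derivative F (at (x, y)) (0, axis i 1) * v $ i)"
      by (rule ext, rule linear_snd_expansion[OF linear_frechet_derivative[OF d]])
    show ?thesis using 2 unfolding 3 by (rule has_derivative_at_withinI)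
  qed
  have G: "G j (x, y) = h x $ j" if x: "x \<in> B1" "y \<in> ball y0 r" for j x y
  proof -
    have "\<exists>c. \<forall>y\<in>ball y0 r. G j (x, y) = c"
    proof (rule has_derivative_zero_constant)
      fix y assume y: "y \<in> ball y0 r"
      then have "(x, y) \<in> D" using x B r by auto
      then have "frechet_derivative (G j) (at (x, y)) (0, axis i 1) = 0" for i
        using hess by (simp add: G_def)
      then show "((\<lambda>y. G j (x, y)) has_derivative (\<lambda>v. 0)) (at y within ball y0 r)"
        using slice[of "G j" x y] x(1) y smooth_on_frechet_derivative[OF f] by (simp add: G_def)
    qed simp
    then show ?thesis using x(2) r(1) by (auto simp: h_def)
  qed
  have eq: "f (x, y) = (\<Sum>i\<in>UNIV. h x $ i * y $ i) + b x"
    if x: "x \<in> B1" "y \<in> ball y0 r" for x y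
  proof -
    have "\<exists>c. \<forall>y\<in>ball y0 r. f (x, y) - (\<Sum>i\<in>UNIV. h x $ i * y $ i) = c"
    proof (rule has_derivative_zero_constant)
      fix y assume y: "y \<in> ball y0 r"
      have 1: "((\<lambda>y. f (x, y)) has_derivative (\<lambda>v. \<Sum>i\<in>UNIV. h x $ i * v $ i)) (at y within ball y0 r)"
        using slice[OF f x(1) y] G[OF x(1) y] by (simp add: G_def)
      have 2: "((\<lambda>y. \<Sum>i\<in>UNIV. h x $ i * y $ i) has_derivative (\<lambda>v. \<Sum>i\<in>UNIV. h x $ i * v $ i)) (at y within ball y0 r)"
        by (intro has_derivative_sum has_derivative_mult_right bounded_linear_imp_has_derivative
            bounded_linear_vec_nth)
      show "((\<lambda>y. f (x, y) - (\<Sum>i\<in>UNIV. h x $ i * y $ i)) has_derivative (\<lambda>v. 0)) (at y within ball y0 r)"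
        using has_derivative_diff[OF 1 2] by simp
    qed simp
    then have "f (x, y) - (\<Sum>i\<in>UNIV. h x $ i * y $ i) = b x"
      using x(2) r(1) by (auto simp: b_def)
    then show ?thesis by simp
  qed
  show ?thesis
    using B r eq D by (intro exI[of _ "B1 \<times> ball y0 r"] exI[of _ h] exI[of _ b])
      (auto simp: open_Times y0_def mem_Times_iff)
qed


section \<open>Sheaves of functions and their first cohomology\<close>

lemma cohomologousE:
  assumes "((V, s), (W, t)) \<in> cohomologous F"
  obtains N a where "(V, s) \<in> cocycles1 F" "(W, t) \<in> cocycles1 F" "point_cover N"
    "\<And>x. N x \<subseteq> V x" "\<And>x. N x \<subseteq> W x" "\<And>x. a x \<in> F (N x)"
    "\<And>x y p. p \<in> N x \<Longrightarrow> p \<in> N y \<Longrightarrow> t x y p - s x y p = a y p - a x p"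
proof -
  from assms obtain N a where "(V, s) \<in> cocycles1 F" "(W, t) \<in> cocycles1 F" "point_cover N"
    "\<forall>x. N x \<subseteq> V x \<inter> W x \<and> a x \<in> F (N x)"
    "\<forall>x y. \<forall>p\<in>N x \<inter> N y. t x y p - s x y p = a y p - a x p"
    unfolding cohomologous_def by auto
  then show thesis by (intro that[of N a]) auto
qed

lemma cohomologousI:
  assumes "(V, s) \<in> cocycles1 F" "(W, t) \<in> cocycles1 F" "point_cover N"
    "\<And>x. N x \<subseteq> V x" "\<And>x. N x \<subseteq> W x" "\<And>x. a x \<in> F (N x)"
    "\<And>x y p. p \<in> N x \<Longrightarrow> p \<in> N y \<Longrightarrow> t x y p - s x y p = a y p - a x p"
  shows "((V, s), (W, t)) \<in> cohomologous F"
  unfolding cohomologous_def using assms by (auto intro!: exI[of _ N] exI[of _ a])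

text \<open>Since sections are total functions, gluing need not construct anything: it states that a
  given function which agrees locally with sections is itself a section. With the single piece
  \<open>W\<close> it also says that values outside \<open>W\<close> are irrelevant.\<close>

locale function_sheaf =
  fixes F :: "'m::topological_space set \<Rightarrow> ('m \<Rightarrow> 'v::ab_group_add) set"
  assumes zero: "open W \<Longrightarrow> (\<lambda>p. 0) \<in> F W"
    and diff: "open W \<Longrightarrow> f \<in> F W \<Longrightarrow> g \<in> F W \<Longrightarrow> (\<lambda>p. f p - g p) \<in> F W"
    and restrict: "f \<in> F W \<Longrightarrow> V \<subseteq> W \<Longrightarrow> open V \<Longrightarrow> f \<in> F V"
    and glue: "open W \<Longrightarrow> (\<And>p. p \<in> W \<Longrightarrow> \<exists>N g. open N \<and> p \<in> N \<and> N \<subseteq> W \<and> g \<in> F N \<and> (\<forall>q\<in>N. f q = g q))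
      \<Longrightarrow> f \<in> F W"
begin

lemma cong: "f \<in> F W \<Longrightarrow> open W \<Longrightarrow> (\<And>p. p \<in> W \<Longrightarrow> f p = g p) \<Longrightarrow> g \<in> F W"
proof (rule glue)
  fix p assume "f \<in> F W" "open W" "\<And>p. p \<in> W \<Longrightarrow> f p = g p" "p \<in> W"
  then show "\<exists>N h. open N \<and> p \<in> N \<and> N \<subseteq> W \<and> h \<in> F N \<and> (\<forall>q\<in>N. g q = h q)"
    by (intro exI[of _ W] exI[of _ f]) simp
qed

lemma minus: "open W \<Longrightarrow> f \<in> F W \<Longrightarrow> (\<lambda>p. - f p) \<in> F W"
  using diff[OF _ zero, of W f] by simp

lemma add: "open W \<Longrightarrow> f \<in> F W \<Longrightarrow> g \<in> F W \<Longrightarrow> (\<lambda>p. f p + g p) \<in> F W"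
  using diff[OF _ _ minus, of W f g] by simp

definition trivial_cocycle :: "('m, 'v) cochain1" where
  "trivial_cocycle = (\<lambda>x. UNIV, \<lambda>x y p. 0)"

lemma trivial_cocycle: "trivial_cocycle \<in> cocycles1 F"
  by (auto simp: trivial_cocycle_def cocycles1_def point_cover_def zero)

lemma H1_zero_eq: "H1_zero F = cohomologous F `` {trivial_cocycle}"
  by (simp add: H1_zero_def trivial_cocycle_def)

text \<open>Zero, negated and added primitives give the three properties. For transitivity both
  primitives are restricted to the common refinement \<open>N x \<inter> N' x\<close>.\<close>

lemma equiv_cohomologous: "equiv (cocycles1 F) (cohomologous F)"
proof (rule equivI)
  show "cohomologous F \<subseteq> cocycles1 F \<times> cocycles1 F" by (auto simp: cohomologous_def)
  show "refl_on (cocycles1 F) (cohomologous F)"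
  proof (rule refl_onI)
    fix X assume X: "X \<in> cocycles1 F"
    obtain V s where "X = (V, s)" by (cases X)
    then show "(X, X) \<in> cohomologous F" using X
      by (auto simp: cohomologous_def cocycles1_def point_cover_def zero intro!: exI[of _ V] exI[of _ "\<lambda>x p. 0"])
  qed
  show "sym (cohomologous F)"
  proof (rule symI)
    fix X Y assume XY: "(X, Y) \<in> cohomologous F"
    obtain V s W t where X: "X = (V, s)" "Y = (W, t)" by (cases X, cases Y)
    from XY[unfolded X] obtain N a where c: "(V, s) \<in> cocycles1 F" "(W, t) \<in> cocycles1 F"
      and N: "point_cover N" "\<And>x. N x \<subseteq> V x" "\<And>x. N x \<subseteq> W x" "\<And>x. a x \<in> F (N x)"
      and a: "\<And>x y p. p \<in> N x \<Longrightarrow> p \<in> N y \<Longrightarrow> t x y p - s x y p = a y p - a x p"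
      by (rule cohomologousE) blast
    show "(Y, X) \<in> cohomologous F" unfolding X
    proof (rule cohomologousI[OF c(2,1) N(1,3,2)])
      show "(\<lambda>p. - a x p) \<in> F (N x)" for x
        using N minus by (simp add: point_cover_def)
      show "s x y p - t x y p = - a y p - - a x p" if "p \<in> N x" "p \<in> N y" for x y p
        using a[OF that] by (simp add: algebra_simps)
    qed
  qed
  show "trans (cohomologous F)"
  proof (rule transI)
    fix X Y Z assume XY: "(X, Y) \<in> cohomologous F" and YZ: "(Y, Z) \<in> cohomologous F"
    obtain V s W t W' t' where X: "X = (V, s)" "Y = (W, t)" "Z = (W', t')"
      by (cases X, cases Y, cases Z)
    from XY[unfolded X] obtain N a where c: "(V, s) \<in> cocycles1 F"
      and N: "point_cover N" "\<And>x. N x \<subseteq> V x" "\<And>x. a x \<in> F (N x)"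
      and a: "\<And>x y p. p \<in> N x \<Longrightarrow> p \<in> N y \<Longrightarrow> t x y p - s x y p = a y p - a x p"
      by (rule cohomologousE) blast
    from YZ[unfolded X] obtain N' a' where c': "(W', t') \<in> cocycles1 F"
      and N': "point_cover N'" "\<And>x. N' x \<subseteq> W' x" "\<And>x. a' x \<in> F (N' x)"
      and a': "\<And>x y p. p \<in> N' x \<Longrightarrow> p \<in> N' y \<Longrightarrow> t' x y p - t x y p = a' y p - a' x p"
      by (rule cohomologousE) blast
    show "(X, Z) \<in> cohomologous F" unfolding X
    proof (rule cohomologousI[OF c c'])
      show "point_cover (\<lambda>x. N x \<inter> N' x)" using N N' by (auto simp: point_cover_def)
      show "N x \<inter> N' x \<subseteq> V x" "N x \<inter> N' x \<subseteq> W' x" for x using N(2) N'(2) by blast+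
      show "(\<lambda>p. a x p + a' x p) \<in> F (N x \<inter> N' x)" for x
      proof -
        have o: "open (N x \<inter> N' x)" using N N' by (auto simp: point_cover_def)
        then show ?thesis
          using restrict[OF N(3) Int_lower1] restrict[OF N'(3) Int_lower2] by (intro add)
      qed
      fix x y p assume p: "p \<in> N x \<inter> N' x" "p \<in> N y \<inter> N' y"
      have "t' x y p - s x y p = (t' x y p - t x y p) + (t x y p - s x y p)" by simp
      also have "\<dots> = (a' y p - a' x p) + (a y p - a x p)" using a a' p by auto
      finally show "t' x y p - s x y p = (a y p + a' y p) - (a x p + a' x p)"
        by (simp add: algebra_simps)
    qed
  qed
qed

lemma cohomologous_sym: "(X, Y) \<in> cohomologous F \<Longrightarrow> (Y, X) \<in> cohomologous F"
  using equiv_cohomologous by (meson equivE symE)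

lemma cohomologous_trans:
  "(X, Y) \<in> cohomologous F \<Longrightarrow> (Y, Z) \<in> cohomologous F \<Longrightarrow> (X, Z) \<in> cohomologous F"
  using equiv_cohomologous by (meson equivE transE)

lemma cohomologous_refl: "X \<in> cocycles1 F \<Longrightarrow> (X, X) \<in> cohomologous F"
  using equiv_class_self[OF equiv_cohomologous] by auto

text \<open>\<open>H1_map\<close> and \<open>cocycle_class\<close> saturate a whole set of
  representatives. The result is the zero class when that set is nonempty, which excludes the empty
  image, and when each representative is cohomologous to the trivial one.\<close>

lemma Image_eq_H1_zeroI:
  assumes "X \<in> Xs" and "\<And>X. X \<in> Xs \<Longrightarrow> (trivial_cocycle, X) \<in> cohomologous F"
  shows "cohomologous F `` Xs = H1_zero F"
proof -
  have "cohomologous F `` {X} = H1_zero F" if "X \<in> Xs" for X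
    using assms(2)[OF that] equiv_class_eq[OF equiv_cohomologous] by (simp add: H1_zero_eq)
  moreover have "cohomologous F `` Xs = (\<Union>X\<in>Xs. cohomologous F `` {X})" by blast
  ultimately show ?thesis using assms(1) by auto
qed

lemma H1_zero_in_H1: "H1_zero F \<in> H1 F"
  by (simp add: H1_zero_eq H1_def quotientI trivial_cocycle)

lemma cohomologous_trivialE:
  assumes "(trivial_cocycle, (W, t)) \<in> cohomologous F"
  obtains N a where "(W, t) \<in> cocycles1 F" "point_cover N"
    "\<And>x. N x \<subseteq> W x" "\<And>x. a x \<in> F (N x)"
    "\<And>x y p. p \<in> N x \<Longrightarrow> p \<in> N y \<Longrightarrow> t x y p = a y p - a x p"
  using assms unfolding trivial_cocycle_def
proof (rule cohomologousE)
  fix N a assume "(W, t) \<in> cocycles1 F" "point_cover N" "\<And>x. N x \<subseteq> W x" "\<And>x. a x \<in> F (N x)"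
    and "\<And>x y p. p \<in> N x \<Longrightarrow> p \<in> N y \<Longrightarrow> t x y p - 0 = a y p - a x p"
  then show thesis by (intro that[of N a]) simp_all
qed

lemma cohomologous_trivialI:
  assumes "(W, t) \<in> cocycles1 F" "point_cover N" "\<And>x. N x \<subseteq> W x" "\<And>x. a x \<in> F (N x)"
    "\<And>x y p. p \<in> N x \<Longrightarrow> p \<in> N y \<Longrightarrow> t x y p = a y p - a x p"
  shows "(trivial_cocycle, (W, t)) \<in> cohomologous F"
  unfolding trivial_cocycle_def using assms trivial_cocycle
  by (intro cohomologousI[of _ _ _ _ _ N a]) (auto simp: trivial_cocycle_def)

end

text \<open>Each of the three sheaves is a sheaf of smooth objects cut out by a normal form
  \<open>R c N\<close> near every point of every adapted chart. The bookkeeping with neighbourhoods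
  is done here once; differences are compared on the intersection of the two neighbourhoods.\<close>

lemma function_sheaf_locally:
  fixes D :: "'c \<Rightarrow> 'm::topological_space set" and G :: "'m::topological_space set \<Rightarrow> ('m \<Rightarrow> 'v::ab_group_add) set"
  assumes "function_sheaf G"
    and z: "\<And>c N. c \<in> X \<Longrightarrow> R c N (\<lambda>p. 0)"
    and d: "\<And>c N f g. c \<in> X \<Longrightarrow> R c N f \<Longrightarrow> R c N g \<Longrightarrow> R c N (\<lambda>p. f p - g p)"
    and s: "\<And>c N N' f. c \<in> X \<Longrightarrow> R c N f \<Longrightarrow> N' \<subseteq> N \<Longrightarrow> R c N' f"
    and e: "\<And>c N f g. c \<in> X \<Longrightarrow> R c N f \<Longrightarrow> (\<And>p. p \<in> N \<Longrightarrow> f p = g p) \<Longrightarrow> R c N g"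
    and o: "\<And>c. c \<in> X \<Longrightarrow> open (D c)"
  shows "function_sheaf (\<lambda>W. {f \<in> G W. \<forall>c\<in>X. \<forall>p\<in>D c \<inter> W.
    \<exists>N. open N \<and> p \<in> N \<and> N \<subseteq> D c \<inter> W \<and> R c N f})"
proof -
  interpret G: function_sheaf G by fact
  define H where "H = (\<lambda>W. {f \<in> G W. \<forall>c\<in>X. \<forall>p\<in>D c \<inter> W.
    \<exists>N. open N \<and> p \<in> N \<and> N \<subseteq> D c \<inter> W \<and> R c N f})"
  have HI: "f \<in> H W" if "f \<in> G W" "\<And>c p. c \<in> X \<Longrightarrow> p \<in> D c \<Longrightarrow> p \<in> W \<Longrightarrow>
      \<exists>N. open N \<and> p \<in> N \<and> N \<subseteq> D c \<inter> W \<and> R c N f" for f W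
    using that by (auto simp: H_def)
  have HG: "f \<in> G W" if "f \<in> H W" for f W using that by (simp add: H_def)
  have HE: "\<exists>N. open N \<and> p \<in> N \<and> N \<subseteq> D c \<inter> W \<and> R c N f"
    if "f \<in> H W" "c \<in> X" "p \<in> D c" "p \<in> W" for f W c p
    using that by (auto simp: H_def)
  have "function_sheaf H"
  proof
    fix W V :: "'m set" and f g :: "'m \<Rightarrow> 'v"
    show "(\<lambda>p. 0) \<in> H W" if W: "open W"
    proof (rule HI)
      show "\<exists>N. open N \<and> p \<in> N \<and> N \<subseteq> D c \<inter> W \<and> R c N (\<lambda>p. 0)"
        if "c \<in> X" "p \<in> D c" "p \<in> W" for c p
        using z o that W by (intro exI[of _ "D c \<inter> W"]) auto
    qed (rule G.zero[OF W])
    show "(\<lambda>p. f p - g p) \<in> H W" if W: "open W" and fg: "f \<in> H W" "g \<in> H W"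
    proof (rule HI)
      fix c p assume c: "c \<in> X" "p \<in> D c" "p \<in> W"
      obtain N N' where "open N" "p \<in> N" "N \<subseteq> D c \<inter> W" "R c N f"
        "open N'" "p \<in> N'" "N' \<subseteq> D c \<inter> W" "R c N' g"
        using HE[OF fg(1) c] HE[OF fg(2) c] by auto
      then show "\<exists>N. open N \<and> p \<in> N \<and> N \<subseteq> D c \<inter> W \<and> R c N (\<lambda>p. f p - g p)"
        by (intro exI[of _ "N \<inter> N'"] conjI d[OF c(1)] s[OF c(1), of N _ "N \<inter> N'"]
            s[OF c(1), of N' _ "N \<inter> N'"]) auto
    qed (use G.diff W fg HG in auto)
    show "f \<in> H V" if f: "f \<in> H W" and V: "V \<subseteq> W" "open V"
    proof (rule HI)
      fix c p assume c: "c \<in> X" "p \<in> D c" "p \<in> V"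
      then obtain N where "open N" "p \<in> N" "N \<subseteq> D c \<inter> W" "R c N f"
        using HE[OF f c(1,2)] V by auto
      then show "\<exists>N. open N \<and> p \<in> N \<and> N \<subseteq> D c \<inter> V \<and> R c N f"
        using c V by (intro exI[of _ "N \<inter> V"] conjI s[OF c(1), of N f "N \<inter> V"]) auto
    qed (rule G.restrict[OF HG[OF f] V])
    show "f \<in> H W" if W: "open W"
      and g: "\<And>p. p \<in> W \<Longrightarrow> \<exists>N g. open N \<and> p \<in> N \<and> N \<subseteq> W \<and> g \<in> H N \<and> (\<forall>q\<in>N. f q = g q)"
    proof (rule HI)
      show "f \<in> G W"
      proof (rule G.glue[OF W])
        fix p assume "p \<in> W"
        from g[OF this] show "\<exists>N g. open N \<and> p \<in> N \<and> N \<subseteq> W \<and> g \<in> G N \<and> (\<forall>q\<in>N. f q = g q)"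
          by (elim exE conjE) (intro exI conjI HG, assumption+)
      qed
      fix c p assume c: "c \<in> X" "p \<in> D c" "p \<in> W"
      then obtain M g where M: "open M" "p \<in> M" "M \<subseteq> W" "g \<in> H M" "\<forall>q\<in>M. f q = g q"
        using g by blast
      then obtain N where "open N" "p \<in> N" "N \<subseteq> D c \<inter> M" "R c N g"
        using HE[OF M(4) c(1,2)] by auto
      then show "\<exists>N. open N \<and> p \<in> N \<and> N \<subseteq> D c \<inter> W \<and> R c N f"
        using M by (intro exI[of _ N] conjI e[OF c(1), of N g f]) auto
    qed
  qed
  then show ?thesis by (simp add: H_def)
qed


section \<open>The three sheaves on a tangent manifold\<close>

locale tangent_structure =
  fixes A :: "('m::{t2_space, second_countable_topology}, 'n::finite) chart set"
    and S :: "('m, 'n) endo_field"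
  assumes tangent: "tangent_manifold A S"
begin

\<comment> \<open>Charts are pairs; quantifiers over them must not be split into components.\<close>
declare split_paired_All [simp del] split_paired_Ex [simp del]

lemma smooth_structure: "smooth_structure A"
  using tangent by (simp add: tangent_manifold_def)

lemma smooth_endo_field: "smooth_endo_field A S"
  using tangent by (simp add: tangent_manifold_def)

lemma adapted_chart_at: obtains c where "adapted A S c" "p \<in> dom_chart c"
  using tangent unfolding tangent_manifold_def by blast

lemma adapted_in_atlas: "adapted A S c \<Longrightarrow> c \<in> A"
  by (simp add: adapted_def)

lemma is_chart: "c \<in> A \<Longrightarrow> is_chart c"
  using smooth_structure unfolding smooth_structure_def by blast

lemma open_dom_chart: "c \<in> A \<Longrightarrow> open (dom_chart c)"
  using is_chart[of c] by (simp add: is_chart_def)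

lemma chart_inv_coord: "c \<in> A \<Longrightarrow> q \<in> dom_chart c \<Longrightarrow> chart_inv c (coord c q) = q"
  using is_chart[of c] by (auto simp: is_chart_def homeomorphism_def)

lemma open_coord_image:
  assumes "c \<in> A" "open W"
  shows "open (coord c ` (dom_chart c \<inter> W))"
proof -
  have hom: "homeomorphism (dom_chart c) (coord c ` dom_chart c) (coord c) (chart_inv c)"
    and opn: "open (coord c ` dom_chart c)"
    using is_chart[OF assms(1)] by (auto simp: is_chart_def)
  have "openin (top_of_set (coord c ` dom_chart c)) (coord c ` (dom_chart c \<inter> W))"
    using homeomorphism_imp_open_map[OF hom, of "dom_chart c \<inter> W"] assms(2)
    by (auto simp: openin_open_Int)
  then show ?thesis using opn openin_open_trans by blast
qed

lemma function_sheaf_smooth_fun: "function_sheaf (\<lambda>W. Collect (smooth_fun A W))"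
proof
  fix W V :: "'m set" and f g :: "'m \<Rightarrow> real"
  show "(\<lambda>p. 0) \<in> Collect (smooth_fun A W)"
    by (simp add: smooth_fun_def smooth_on_const)
  show "(\<lambda>p. f p - g p) \<in> Collect (smooth_fun A W)"
    if "open W" "f \<in> Collect (smooth_fun A W)" "g \<in> Collect (smooth_fun A W)"
    using that by (auto simp: smooth_fun_def intro!: smooth_on_diff open_coord_image)
  show "f \<in> Collect (smooth_fun A V)"
    if f: "f \<in> Collect (smooth_fun A W)" and V: "V \<subseteq> W"
    unfolding smooth_fun_def mem_Collect_eq
  proof
    fix c assume "c \<in> A"
    then have "smooth_on (coord c ` (dom_chart c \<inter> W)) (\<lambda>z. f (chart_inv c z))"
      using f by (simp add: smooth_fun_def)
    then show "smooth_on (coord c ` (dom_chart c \<inter> V)) (\<lambda>z. f (chart_inv c z))"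
      by (rule smooth_on_subset) (use V in blast)
  qed
  show "f \<in> Collect (smooth_fun A W)"
    if W: "open W" and g: "\<And>p. p \<in> W \<Longrightarrow> \<exists>N g. open N \<and> p \<in> N \<and> N \<subseteq> W \<and>
      g \<in> Collect (smooth_fun A N) \<and> (\<forall>q\<in>N. f q = g q)"
    unfolding smooth_fun_def mem_Collect_eq
  proof (intro ballI smooth_on_locally)
    fix c z assume c: "c \<in> A" and "z \<in> coord c ` (dom_chart c \<inter> W)"
    then obtain p where p: "p \<in> dom_chart c" "p \<in> W" "z = coord c p" by auto
    obtain N g where N: "open N" "p \<in> N" "smooth_fun A N g" "\<forall>q\<in>N. f q = g q"
      using g[OF p(2)] by auto
    let ?E = "coord c ` (dom_chart c \<inter> N)"
    have o: "open ?E" using open_coord_image c N by blast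
    have "smooth_on ?E (\<lambda>z. g (chart_inv c z))" using N c by (simp add: smooth_fun_def)
    then have "smooth_on ?E (\<lambda>z. f (chart_inv c z))"
      by (rule smooth_on_cong[OF _ o]) (use N chart_inv_coord[OF c] in auto)
    then show "\<exists>E. open E \<and> z \<in> E \<and> smooth_on E (\<lambda>z. f (chart_inv c z))"
      using o p N by blast
  qed
qed

text \<open>Linearity, the normalisation outside the chart and the transformation law are pointwise,
  so they pass from \<open>g\<close> to \<open>f\<close> at a single point. Only smoothness uses
  agreement on a neighbourhood.\<close>

lemma function_sheaf_one_form_on: "function_sheaf (\<lambda>W. Collect (one_form_on A W))"
proof
  fix W V :: "'m set" and f g :: "('m, 'n) one_form"
  show "(\<lambda>p. 0) \<in> Collect (one_form_on A W)"
    by (auto simp: one_form_on_def smooth_on_const linear_iff)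
  show "(\<lambda>p. f p - g p) \<in> Collect (one_form_on A W)"
    if "open W" "f \<in> Collect (one_form_on A W)" "g \<in> Collect (one_form_on A W)"
    unfolding one_form_on_def mem_Collect_eq fun_diff_def
    using that
    by (auto simp: one_form_on_def intro!: smooth_on_diff open_coord_image linear_compose_sub)
  show "f \<in> Collect (one_form_on A V)"
    if f: "f \<in> Collect (one_form_on A W)" and V: "V \<subseteq> W"
    unfolding one_form_on_def mem_Collect_eq
  proof (intro conjI ballI allI)
    fix c v assume "c \<in> A"
    then have "smooth_on (coord c ` (dom_chart c \<inter> W)) (\<lambda>z. f (chart_inv c z) c v)"
      using f by (simp add: one_form_on_def)
    then show "smooth_on (coord c ` (dom_chart c \<inter> V)) (\<lambda>z. f (chart_inv c z) c v)"
      by (rule smooth_on_subset) (use V in blast)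
  qed (use f V in \<open>auto simp: one_form_on_def\<close>)
  show "f \<in> Collect (one_form_on A W)"
    if W: "open W" and g: "\<And>p. p \<in> W \<Longrightarrow> \<exists>N g. open N \<and> p \<in> N \<and> N \<subseteq> W \<and>
      g \<in> Collect (one_form_on A N) \<and> (\<forall>q\<in>N. f q = g q)"
    unfolding one_form_on_def mem_Collect_eq
  proof (intro conjI ballI allI)
    fix p c assume p: "p \<in> W"
    obtain N g where N: "p \<in> N" "one_form_on A N g" "f p = g p" using g[OF p] by auto
    then show "c \<in> A \<and> p \<in> dom_chart c \<longrightarrow> linear (f p c)"
      "\<not> (c \<in> A \<and> p \<in> dom_chart c) \<longrightarrow> f p c = (\<lambda>v. 0)"
      by (auto simp: one_form_on_def)
  next
    fix c d p v assume cd: "c \<in> A" "d \<in> A" and p: "p \<in> dom_chart c \<inter> dom_chart d \<inter> W"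
    then obtain N g where N: "p \<in> N" "one_form_on A N g" "f p = g p" using g[of p] by auto
    have "g p d (jac c d p v) = g p c v"
      using N(1,2) cd p by (auto simp: one_form_on_def)
    with N show "f p d (jac c d p v) = f p c v" by simp
  next
    fix c v assume c: "c \<in> A"
    show "smooth_on (coord c ` (dom_chart c \<inter> W)) (\<lambda>z. f (chart_inv c z) c v)"
    proof (rule smooth_on_locally)
      fix z assume "z \<in> coord c ` (dom_chart c \<inter> W)"
      then obtain p where p: "p \<in> dom_chart c" "p \<in> W" "z = coord c p" by auto
      obtain N g where N: "open N" "p \<in> N" "one_form_on A N g" "\<forall>q\<in>N. f q = g q"
        using g[OF p(2)] by auto
      let ?E = "coord c ` (dom_chart c \<inter> N)"
      have o: "open ?E" using open_coord_image c N by blast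
      have "smooth_on ?E (\<lambda>z. g (chart_inv c z) c v)" using N c by (simp add: one_form_on_def)
      then have "smooth_on ?E (\<lambda>z. f (chart_inv c z) c v)"
        by (rule smooth_on_cong[OF _ o]) (use N chart_inv_coord[OF c] in auto)
      then show "\<exists>E. open E \<and> z \<in> E \<and> smooth_on E (\<lambda>z. f (chart_inv c z) c v)"
        using o p N by blast
    qed
  qed
qed

lemma function_sheaf_foliated_fun: "function_sheaf (foliated_fun A S)"
proof -
  \<comment> \<open>The coefficient \<open>b\<close> is moved behind the conditions on
    \<open>N\<close>, which exhibits the normal form as a predicate of chart, neighbourhood and
    section.\<close>
  have eq: "foliated_fun A S = (\<lambda>W. {f \<in> Collect (smooth_fun A W).
      \<forall>c\<in>{c. adapted A S c}. \<forall>p\<in>dom_chart c \<inter> W.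
        \<exists>N. open N \<and> p \<in> N \<and> N \<subseteq> dom_chart c \<inter> W \<and>
          (\<exists>b. \<forall>q\<in>N. f q = b (fst (coord c q)))})"
    by (rule ext) (simp only: foliated_fun_def mem_Collect_eq Ball_def ex_simps)
  show ?thesis unfolding eq
  proof (rule function_sheaf_locally[OF function_sheaf_smooth_fun], goal_cases)
    case (1 c N)
    then show ?case by (intro exI[of _ "\<lambda>_. 0"]) simp
  next
    case (2 c N f g)
    then obtain b b' where "\<forall>q\<in>N. f q = b (fst (coord c q))" "\<forall>q\<in>N. g q = b' (fst (coord c q))"
      by blast
    then show ?case by (intro exI[of _ "\<lambda>x. b x - b' x"]) simp
  next
    case 3
    then show ?case by blast
  next
    case 4
    then show ?case by auto
  next
    case 5
    then show ?case using open_dom_chart adapted_in_atlas by simp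
  qed
qed

lemma function_sheaf_leafwise_affine: "function_sheaf (leafwise_affine A S)"
proof -
  have eq: "leafwise_affine A S = (\<lambda>W. {f \<in> Collect (smooth_fun A W).
      \<forall>c\<in>{c. adapted A S c}. \<forall>p\<in>dom_chart c \<inter> W.
        \<exists>N. open N \<and> p \<in> N \<and> N \<subseteq> dom_chart c \<inter> W \<and>
          (\<exists>(h :: real ^ 'n \<Rightarrow> real ^ 'n) b. \<forall>q\<in>N. f q =
            (\<Sum>i\<in>UNIV. h (fst (coord c q)) $ i * snd (coord c q) $ i) + b (fst (coord c q)))})"
    by (rule ext) (simp only: leafwise_affine_def mem_Collect_eq Ball_def ex_simps)
  show ?thesis unfolding eq
  proof (rule function_sheaf_locally[OF function_sheaf_smooth_fun], goal_cases)
    case (1 c N)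
    then show ?case by (intro exI[of _ "\<lambda>_. 0"]) simp
  next
    case (2 c N f g)
    then obtain h h' :: "real ^ 'n \<Rightarrow> real ^ 'n" and b b' where
      "\<forall>q\<in>N. f q = (\<Sum>i\<in>UNIV. h (fst (coord c q)) $ i * snd (coord c q) $ i) + b (fst (coord c q))"
      "\<forall>q\<in>N. g q = (\<Sum>i\<in>UNIV. h' (fst (coord c q)) $ i * snd (coord c q) $ i) + b' (fst (coord c q))"
      by blast
    then show ?case
      by (intro exI[of _ "\<lambda>x. h x - h' x"] exI[of _ "\<lambda>x. b x - b' x"])
        (simp add: left_diff_distrib sum_subtractf)
  next
    case 3
    then show ?case by blast
  next
    case 4
    then show ?case by auto
  next
    case 5
    then show ?case using open_dom_chart adapted_in_atlas by simp
  qed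
qed

lemma function_sheaf_foliated_form: "function_sheaf (foliated_form A S)"
proof -
  have eq: "foliated_form A S = (\<lambda>W. {\<omega> \<in> Collect (one_form_on A W).
      \<forall>c\<in>{c. adapted A S c}. \<forall>p\<in>dom_chart c \<inter> W.
        \<exists>N. open N \<and> p \<in> N \<and> N \<subseteq> dom_chart c \<inter> W \<and>
          (\<exists>h :: real ^ 'n \<Rightarrow> real ^ 'n. \<forall>q\<in>N. \<forall>u w.
            \<omega> q c (u, w) = (\<Sum>i\<in>UNIV. h (fst (coord c q)) $ i * u $ i))})"
    by (rule ext) (simp only: foliated_form_def mem_Collect_eq Ball_def ex_simps)
  show ?thesis unfolding eq
  proof (rule function_sheaf_locally[OF function_sheaf_one_form_on], goal_cases)
    case (1 c N)
    then show ?case by (intro exI[of _ "\<lambda>_. 0"]) simp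
  next
    case (2 c N f g)
    then obtain h h' :: "real ^ 'n \<Rightarrow> real ^ 'n" where
      "\<forall>q\<in>N. \<forall>u w. f q c (u, w) = (\<Sum>i\<in>UNIV. h (fst (coord c q)) $ i * u $ i)"
      "\<forall>q\<in>N. \<forall>u w. g q c (u, w) = (\<Sum>i\<in>UNIV. h' (fst (coord c q)) $ i * u $ i)"
      by blast
    then show ?case
      by (intro exI[of _ "\<lambda>x. h x - h' x"]) (simp add: left_diff_distrib sum_subtractf)
  next
    case 3
    then show ?case by blast
  next
    case 4
    then show ?case by auto
  next
    case 5
    then show ?case using open_dom_chart adapted_in_atlas by simp
  qed
qed

sublocale smooth: function_sheaf "\<lambda>W. Collect (smooth_fun A W)"
  by (rule function_sheaf_smooth_fun)
sublocale fol: function_sheaf "foliated_fun A S" by (rule function_sheaf_foliated_fun)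
sublocale aff: function_sheaf "leafwise_affine A S" by (rule function_sheaf_leafwise_affine)
sublocale form: function_sheaf "foliated_form A S" by (rule function_sheaf_foliated_form)

section \<open>The inclusion of foliated functions and the projection to foliated forms\<close>

lemma foliated_fun_subset: "foliated_fun A S W \<subseteq> leafwise_affine A S W"
proof
  fix f assume f: "f \<in> foliated_fun A S W"
  show "f \<in> leafwise_affine A S W"
    unfolding leafwise_affine_def mem_Collect_eq
  proof (intro conjI allI impI ballI)
    show "smooth_fun A W f" using f by (simp add: foliated_fun_def)
    fix c p assume "adapted A S c" "p \<in> dom_chart c \<inter> W"
    then obtain N b where "open N" "p \<in> N" "N \<subseteq> dom_chart c \<inter> W" "\<forall>q\<in>N. f q = b (fst (coord c q))"
      using f unfolding foliated_fun_def by blast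
    then show "\<exists>N (h :: real ^ 'n \<Rightarrow> real ^ 'n) b. open N \<and> p \<in> N \<and> N \<subseteq> dom_chart c \<inter> W \<and>
        (\<forall>q\<in>N. f q = (\<Sum>i\<in>UNIV. h (fst (coord c q)) $ i * snd (coord c q) $ i) + b (fst (coord c q)))"
      by (intro exI[of _ N] exI[of _ "\<lambda>_. 0"] exI[of _ b]) simp
  qed
qed

lemma smooth_fun_if_leafwise_affine: "f \<in> leafwise_affine A S W \<Longrightarrow> smooth_fun A W f"
  by (simp add: leafwise_affine_def)

lemma smooth_fun_differentiable:
  assumes "smooth_fun A W f" "c \<in> A" "p \<in> dom_chart c" "p \<in> W"
  shows "(\<lambda>z. f (chart_inv c z)) differentiable (at (coord c p))"
  using assms unfolding smooth_fun_def by (blast intro: smooth_on_imp_differentiable)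

text \<open>The chain rule for \<open>f\<close> read in \<open>d\<close> after the change of
  coordinates. This composite is \<open>f\<close> read in \<open>c\<close> only on the overlap of
  the charts, whose image is open, so the derivatives coincide.\<close>

lemma dfun_jac:
  assumes f: "smooth_fun A W f" and cd: "c \<in> A" "d \<in> A"
    and p: "p \<in> dom_chart c" "p \<in> dom_chart d" "p \<in> W"
  shows "dfun f p d (jac c d p v) = dfun f p c v"
proof -
  let ?T = "transition c d" and ?F = "\<lambda>z. f (chart_inv d z)"
  have Tp: "?T (coord c p) = coord d p"
    using chart_inv_coord[OF cd(1) p(1)] by (simp add: transition_def)
  have "compatible c d" using smooth_structure cd unfolding smooth_structure_def by blast
  then have "?T differentiable (at (coord c p))"
    using p by (auto simp: compatible_def intro: smooth_on_imp_differentiable)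
  then have 1: "(?T has_derivative jac c d p) (at (coord c p))"
    by (simp add: jac_def frechet_derivative_works)
  have 2: "(?F has_derivative dfun f p d) (at (?T (coord c p)))"
    using smooth_fun_differentiable[OF f cd(2) p(2,3)]
    by (simp add: Tp dfun_def frechet_derivative_works)
  have "dfun f p d \<circ> jac c d p = frechet_derivative (?F \<circ> ?T) (at (coord c p))"
    by (rule frechet_derivative_at[OF diff_chain_at[OF 1 2]])
  also have "\<dots> = dfun f p c"
    unfolding dfun_def
  proof (rule frechet_derivative_cong_open[OF open_coord_image[OF cd(1) open_dom_chart[OF cd(2)]]])
    show "coord c p \<in> coord c ` (dom_chart c \<inter> dom_chart d)" using p by blast
    fix w assume "w \<in> coord c ` (dom_chart c \<inter> dom_chart d)"
    then show "(?F \<circ> ?T) w = f (chart_inv c w)"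
      using chart_inv_coord[OF cd(1)] chart_inv_coord[OF cd(2)] by (auto simp: transition_def)
  qed
  finally show ?thesis by (metis comp_apply)
qed

text \<open>\<open>S\<close> commutes with the Jacobians and \<open>df\<close> is invariant, hence
  so is \<open>df \<circ> S\<close>. Identities for the projection can thus be verified in one
  adapted chart and carried to all others.\<close>

lemma proj_form_jac:
  assumes f: "smooth_fun A W f" and cd: "c \<in> A" "d \<in> A"
    and p: "p \<in> dom_chart c" "p \<in> dom_chart d" "p \<in> W"
  shows "proj_form A S f p d (jac c d p v) = proj_form A S f p c v"
proof -
  have "S p d (jac c d p v) = jac c d p (S p c v)"
    using smooth_endo_field cd p by (auto simp: smooth_endo_field_def)
  then show ?thesis using cd p dfun_jac[OF f cd p] by (simp add: proj_form_def)
qed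

text \<open>The projection differentiates, so it depends only on the germ. This makes it act on
  cochains, whose identities hold merely on the members of a covering and their
  intersections.\<close>

lemma proj_form_cong:
  assumes N: "open N" "p \<in> N" and eq: "\<And>q. q \<in> N \<Longrightarrow> f q = g q"
  shows "proj_form A S f p = proj_form A S g p"
proof -
  have "dfun f p c = dfun g p c" if c: "c \<in> A" "p \<in> dom_chart c" for c
    unfolding dfun_def
    by (rule frechet_derivative_cong_open[OF open_coord_image[OF c(1) N(1)]])
      (use c N eq chart_inv_coord[OF c(1)] in auto)
  then show ?thesis by (intro ext) (simp add: proj_form_def)
qed

lemma proj_form_zero: "proj_form A S (\<lambda>p. 0) p = 0"
  by (auto simp: proj_form_def dfun_def fun_eq_iff)

lemma proj_form_diff:
  assumes "smooth_fun A W f" "smooth_fun A W g" "p \<in> W"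
  shows "proj_form A S (\<lambda>q. f q - g q) p = proj_form A S f p - proj_form A S g p"
  using assms smooth_fun_differentiable
  by (auto simp: proj_form_def dfun_def fun_eq_iff intro!: frechet_derivative_diff)

lemma one_form_on_proj_form:
  assumes W: "open W" and f: "smooth_fun A W f"
  shows "one_form_on A W (proj_form A S f)"
  unfolding one_form_on_def
proof (intro conjI ballI allI impI)
  fix p c assume p: "p \<in> W" and c: "c \<in> A \<and> p \<in> dom_chart c"
  have "linear (dfun f p c)"
    unfolding dfun_def using linear_frechet_derivative smooth_fun_differentiable[OF f] c p by blast
  moreover have "linear (S p c)" using smooth_endo_field c by (simp add: smooth_endo_field_def)
  ultimately show "linear (proj_form A S f p c)"
    using linear_compose[of "S p c" "dfun f p c"] c by (simp add: proj_form_def o_def)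
next
  fix p c assume "\<not> (c \<in> A \<and> p \<in> dom_chart c)"
  then show "proj_form A S f p c = (\<lambda>v. 0)" by (auto simp: proj_form_def)
next
  fix c d p v assume "c \<in> A" "d \<in> A" "p \<in> dom_chart c \<inter> dom_chart d \<inter> W"
  then show "proj_form A S f p d (jac c d p v) = proj_form A S f p c v"
    using proj_form_jac[OF f] by auto
next
  fix c v assume c: "c \<in> A"
  let ?D = "coord c ` (dom_chart c \<inter> W)"
  have D: "open ?D" by (rule open_coord_image[OF c W])
  have "smooth_on (coord c ` dom_chart c) (\<lambda>z. S (chart_inv c z) c v)"
    using smooth_endo_field c by (simp add: smooth_endo_field_def)
  then have "smooth_on ?D (\<lambda>z. S (chart_inv c z) c v)" by (rule smooth_on_subset) blast
  moreover have "smooth_on ?D (\<lambda>z. f (chart_inv c z))"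
    using f c by (simp add: smooth_fun_def)
  \<comment> \<open>The chart \<open>c\<close> is an arbitrary member of the atlas, so
    \<open>S\<close> applied to a fixed \<open>v\<close> is a vector field that varies with the
    point.\<close>
  ultimately have "smooth_on ?D
      (\<lambda>z. frechet_derivative (\<lambda>z. f (chart_inv c z)) (at z) (S (chart_inv c z) c v))"
    by (intro smooth_on_frechet_derivative_field D)
  then show "smooth_on ?D (\<lambda>z. proj_form A S f (chart_inv c z) c v)"
    by (rule smooth_on_cong[OF _ D])
      (use c chart_inv_coord[OF c] in \<open>auto simp: proj_form_def dfun_def\<close>)
qed

text \<open>The neighbourhood and the coefficients \<open>h\<close> of the affine expression serve
  again for the form, because \<open>proj_form_adapted\<close> applies at each point of
  \<open>N\<close> and not only at \<open>p\<close>.\<close>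

lemma proj_form_leafwise_affine:
  assumes W: "open W" and f: "f \<in> leafwise_affine A S W"
  shows "proj_form A S f \<in> foliated_form A S W"
  unfolding foliated_form_def mem_Collect_eq
proof (intro conjI allI impI ballI)
  have sf: "smooth_fun A W f" by (rule smooth_fun_if_leafwise_affine[OF f])
  then show "one_form_on A W (proj_form A S f)" by (rule one_form_on_proj_form[OF W])
  fix c p assume c: "adapted A S c" and p: "p \<in> dom_chart c \<inter> W"
  obtain N and h :: "real ^ 'n \<Rightarrow> real ^ 'n" and b where N: "open N" "p \<in> N" "N \<subseteq> dom_chart c \<inter> W"
    and eq: "\<And>q. q \<in> N \<Longrightarrow> f q = (\<Sum>i\<in>UNIV. h (fst (coord c q)) $ i * snd (coord c q) $ i)
      + b (fst (coord c q))"
    using f[unfolded leafwise_affine_def mem_Collect_eq, THEN conjunct2, rule_format, OF c p] by auto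
  have "proj_form A S f q c (u, w) = (\<Sum>i\<in>UNIV. h (fst (coord c q)) $ i * u $ i)"
    if "q \<in> N" for q u w
    by (rule proj_form_adapted[OF smooth_structure c sf N(1) that N(3) eq])
  then show "\<exists>N (h :: real ^ 'n \<Rightarrow> real ^ 'n). open N \<and> p \<in> N \<and> N \<subseteq> dom_chart c \<inter> W \<and>
      (\<forall>q\<in>N. \<forall>u w. proj_form A S f q c (u, w) = (\<Sum>i\<in>UNIV. h (fst (coord c q)) $ i * u $ i))"
    using N by blast
qed

text \<open>The composite of inclusion and projection vanishes: in an adapted chart a foliated
  function is the case \<open>h = 0\<close>, and \<open>proj_form_jac\<close> transports the result
  to the remaining charts.\<close>

lemma proj_form_foliated:
  assumes f: "f \<in> foliated_fun A S W" and p: "p \<in> W"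
  shows "proj_form A S f p = 0"
proof (intro ext)
  have sf: "smooth_fun A W f" using f by (simp add: foliated_fun_def)
  obtain d where d: "adapted A S d" "p \<in> dom_chart d" by (rule adapted_chart_at)
  obtain N b where N: "open N" "p \<in> N" "N \<subseteq> dom_chart d \<inter> W"
    and eq: "\<And>q. q \<in> N \<Longrightarrow> f q = b (fst (coord d q))"
    using f[unfolded foliated_fun_def mem_Collect_eq, THEN conjunct2, rule_format, OF d(1) IntI[OF d(2) p]]
    by auto
  have zero: "proj_form A S f p d (u, w) = 0" for u w
    using proj_form_adapted[OF smooth_structure d(1) sf N, of "\<lambda>_. 0" b] eq by simp
  fix c v
  show "proj_form A S f p c v = 0 c v"
  proof (cases "c \<in> A \<and> p \<in> dom_chart c")
    case True
    then have "proj_form A S f p c v = proj_form A S f p d (jac c d p v)"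
      using proj_form_jac[OF sf] adapted_in_atlas d p by simp
    then show ?thesis using zero[of "fst (jac c d p v)" "snd (jac c d p v)"] by simp
  qed (auto simp: proj_form_def)
qed

section \<open>Functions with equal vertical Hessians\<close>

lemma leafwise_affine_diff_if_hess_eq:
  assumes W: "open W" and f: "smooth_fun A W f" and g: "smooth_fun A W g"
    and hess: "\<And>c p. adapted A S c \<Longrightarrow> p \<in> dom_chart c \<Longrightarrow> p \<in> W \<Longrightarrow> hess f p c = hess g p c"
  shows "(\<lambda>p. f p - g p) \<in> leafwise_affine A S W"
  unfolding leafwise_affine_def mem_Collect_eq
proof (intro conjI allI impI ballI)
  show sfg: "smooth_fun A W (\<lambda>p. f p - g p)" using smooth.diff[OF W] f g by simp
  fix c p assume ad: "adapted A S c" and p: "p \<in> dom_chart c \<inter> W"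
  have c: "c \<in> A" by (rule adapted_in_atlas[OF ad])
  let ?D = "coord c ` (dom_chart c \<inter> W)"
  let ?f = "\<lambda>z. f (chart_inv c z)" and ?g = "\<lambda>z. g (chart_inv c z)"
  have D: "open ?D" by (rule open_coord_image[OF c W])
  have sm: "smooth_on ?D ?f" "smooth_on ?D ?g" "smooth_on ?D (\<lambda>z. ?f z - ?g z)"
    using f g sfg c by (auto simp: smooth_fun_def)
  have "frechet_derivative (\<lambda>z. frechet_derivative (\<lambda>z. ?f z - ?g z) (at z) (0, axis j 1)) (at z)
      (0, axis i 1) = 0" if z: "z \<in> ?D" for z i j
  proof -
    let ?G = "\<lambda>F z. frechet_derivative F (at z) (0, axis j (1::real))"
    obtain q where q: "q \<in> dom_chart c" "q \<in> W" "z = coord c q" using z by auto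
    have diff: "?G ?f differentiable (at z)" "?G ?g differentiable (at z)"
      using sm z smooth_on_frechet_derivative smooth_on_imp_differentiable by blast+
    \<comment> \<open>The inner derivative is additive on \<open>?D\<close>, where both functions
      are smooth; openness of \<open>?D\<close> carries the identity under the outer
      derivative.\<close>
    have "frechet_derivative (?G (\<lambda>z. ?f z - ?g z)) (at z) (0, axis i 1)
        = frechet_derivative (\<lambda>z. ?G ?f z - ?G ?g z) (at z) (0, axis i 1)"
    proof (rule arg_cong[where f = "\<lambda>F. F _"], rule frechet_derivative_cong_open[OF D z])
      fix w assume "w \<in> ?D"
      then show "?G (\<lambda>z. ?f z - ?g z) w = ?G ?f w - ?G ?g w"
        using sm smooth_on_imp_differentiable by (intro frechet_derivative_diff) blast+
    qed
    also have "\<dots> = hess f q c $ i $ j - hess g q c $ i $ j"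
      using frechet_derivative_diff[OF diff] q by (simp add: hess_def)
    also have "\<dots> = 0" using hess ad q by simp
    finally show ?thesis .
  qed
  from leafwise_affine_if_zero_hessian[OF D _ sm(3) this, of "coord c p"]
  obtain N and h :: "real ^ 'n \<Rightarrow> real ^ 'n" and b where N: "open N" "coord c p \<in> N" "N \<subseteq> ?D"
    and eq: "\<And>z. z \<in> N \<Longrightarrow> ?f z - ?g z = (\<Sum>i\<in>UNIV. h (fst z) $ i * snd z $ i) + b (fst z)"
    using p by blast
  define N' where "N' = dom_chart c \<inter> coord c -` N"
  have eq': "f q - g q = (\<Sum>i\<in>UNIV. h (fst (coord c q)) $ i * snd (coord c q) $ i)
      + b (fst (coord c q))" if "q \<in> N'" for q
    using eq[of "coord c q"] chart_inv_coord[OF c, of q] that by (simp add: N'_def)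
  have "continuous_on (dom_chart c) (coord c)"
    using is_chart[OF c] by (auto simp: is_chart_def homeomorphism_def)
  then have "open N'"
    using continuous_on_open_vimage[OF open_dom_chart[OF c]] N(1)
    unfolding N'_def by (auto simp: Int_commute)
  \<comment> \<open>Points of \<open>N\<close> are coordinates of some point of \<open>W\<close>;
    injectivity of the chart identifies that point with \<open>q\<close>.\<close>
  moreover have "N' \<subseteq> dom_chart c \<inter> W"
  proof
    fix q assume q: "q \<in> N'"
    then obtain q' where "q' \<in> dom_chart c" "q' \<in> W" "coord c q = coord c q'"
      using N by (auto simp: N'_def)
    then show "q \<in> dom_chart c \<inter> W" using q chart_inv_coord[OF c] by (metis IntD1 IntI N'_def)
  qed
  ultimately show "\<exists>N (h :: real ^ 'n \<Rightarrow> real ^ 'n) b. open N \<and> p \<in> N \<and> N \<subseteq> dom_chart c \<inter> W \<and>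
      (\<forall>q\<in>N. f q - g q = (\<Sum>i\<in>UNIV. h (fst (coord c q)) $ i * snd (coord c q) $ i)
        + b (fst (coord c q)))"
    using p N(2) eq'
    by (intro exI[of _ N'] exI[of _ h] exI[of _ b]) (simp add: N'_def)
qed


section \<open>Induced maps on first cohomology\<close>

lemma cocycles1_foliated_subset: "cocycles1 (foliated_fun A S) \<subseteq> cocycles1 (leafwise_affine A S)"
  using foliated_fun_subset by (fastforce simp: cocycles1_def)

lemma cohomologous_foliated_subset:
  "cohomologous (foliated_fun A S) \<subseteq> cohomologous (leafwise_affine A S)"
proof (rule subrelI)
  fix X Y assume XY: "(X, Y) \<in> cohomologous (foliated_fun A S)"
  obtain V s W t where X: "X = (V, s)" "Y = (W, t)" by (cases X, cases Y)
  from XY[unfolded X] obtain N a where c: "(V, s) \<in> cocycles1 (foliated_fun A S)"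
      "(W, t) \<in> cocycles1 (foliated_fun A S)"
    and N: "point_cover N" "\<And>x. N x \<subseteq> V x" "\<And>x. N x \<subseteq> W x" "\<And>x. a x \<in> foliated_fun A S (N x)"
    and a: "\<And>x y p. p \<in> N x \<Longrightarrow> p \<in> N y \<Longrightarrow> t x y p - s x y p = a y p - a x p"
    by (rule cohomologousE) blast
  show "(X, Y) \<in> cohomologous (leafwise_affine A S)" unfolding X
    by (rule cohomologousI[OF _ _ N(1-3) _ a])
      (use c cocycles1_foliated_subset N(4) foliated_fun_subset in blast)+
qed

lemma H1_map_id: "H1_map G id C = cohomologous G `` C"
  by (simp add: H1_map_def split_beta)

lemma H1_map_inclusion_zero:
  "H1_map (leafwise_affine A S) id (H1_zero (foliated_fun A S)) = H1_zero (leafwise_affine A S)"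
  unfolding H1_map_id
proof (rule aff.Image_eq_H1_zeroI)
  show "aff.trivial_cocycle \<in> H1_zero (foliated_fun A S)"
    using fol.cohomologous_refl[OF fol.trivial_cocycle]
    by (simp add: fol.H1_zero_eq fol.trivial_cocycle_def aff.trivial_cocycle_def)
  fix X assume "X \<in> H1_zero (foliated_fun A S)"
  then show "(aff.trivial_cocycle, X) \<in> cohomologous (leafwise_affine A S)"
    using cohomologous_foliated_subset
    by (auto simp: fol.H1_zero_eq fol.trivial_cocycle_def aff.trivial_cocycle_def)
qed

lemma proj_form_cocycle:
  assumes "(W, t) \<in> cocycles1 (leafwise_affine A S)"
  shows "(W, \<lambda>x y. proj_form A S (t x y)) \<in> cocycles1 (foliated_form A S)"
proof -
  have W: "point_cover W" and t: "\<And>x y. t x y \<in> leafwise_affine A S (W x \<inter> W y)"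
    and add: "\<And>x y z p. p \<in> W x \<inter> W y \<inter> W z \<Longrightarrow> t x y p + t y z p = t x z p"
    using assms by (auto simp: cocycles1_def)
  have o: "open (W x)" for x using W by (simp add: point_cover_def)
  have "proj_form A S (t x y) p + proj_form A S (t y z) p = proj_form A S (t x z) p"
    if p: "p \<in> W x \<inter> W y \<inter> W z" for x y z p
  proof -
    let ?N = "W x \<inter> W y \<inter> W z"
    have sm: "smooth_fun A ?N (t x z)" "smooth_fun A ?N (t y z)"
      using aff.restrict[OF t, of ?N x z] aff.restrict[OF t, of ?N y z] o
      by (auto intro!: smooth_fun_if_leafwise_affine)
    \<comment> \<open>The cocycle identity is solved for \<open>t x y\<close>, so that additivity of
      the projection is reached through differences on the open triple intersection.\<close>
    have "proj_form A S (t x y) p = proj_form A S (\<lambda>q. t x z q - t y z q) p"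
      using p o add by (intro proj_form_cong[of ?N]) (auto simp: eq_diff_eq)
    also have "\<dots> = proj_form A S (t x z) p - proj_form A S (t y z) p"
      by (rule proj_form_diff[OF sm p])
    finally show ?thesis by simp
  qed
  moreover have "proj_form A S (t x y) \<in> foliated_form A S (W x \<inter> W y)" for x y
    using o t by (intro proj_form_leafwise_affine) auto
  ultimately show ?thesis using W by (auto simp: cocycles1_def)
qed

lemma H1_map_proj_form_zero:
  "H1_map (foliated_form A S) (proj_form A S) (H1_zero (leafwise_affine A S))
    = H1_zero (foliated_form A S)"
  unfolding H1_map_def
proof (rule form.Image_eq_H1_zeroI)
  \<comment> \<open>The projection takes the trivial cocycle literally to the trivial cocycle, which
    provides the member required for a nonempty image.\<close>
  have "(\<lambda>(x::'m) (y::'m). proj_form A S (\<lambda>p. 0)) = (\<lambda>x y p. 0)"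
    using proj_form_zero by (intro ext) metis
  then show "form.trivial_cocycle
      \<in> (\<lambda>(W, s). (W, \<lambda>x y. proj_form A S (s x y))) ` H1_zero (leafwise_affine A S)"
    using aff.cohomologous_refl[OF aff.trivial_cocycle]
    by (intro image_eqI[of _ _ "aff.trivial_cocycle"])
      (simp_all add: aff.H1_zero_eq form.trivial_cocycle_def aff.trivial_cocycle_def)
  fix X assume "X \<in> (\<lambda>(W, s). (W, \<lambda>x y. proj_form A S (s x y))) ` H1_zero (leafwise_affine A S)"
  then obtain W t where X: "X = (W, \<lambda>x y. proj_form A S (t x y))"
    and "(aff.trivial_cocycle, (W, t)) \<in> cohomologous (leafwise_affine A S)"
    by (auto simp: aff.H1_zero_eq)
  then obtain N a where c: "(W, t) \<in> cocycles1 (leafwise_affine A S)"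
    and N: "point_cover N" "\<And>x. N x \<subseteq> W x" "\<And>x. a x \<in> leafwise_affine A S (N x)"
    and a: "\<And>x y p. p \<in> N x \<Longrightarrow> p \<in> N y \<Longrightarrow> t x y p = a y p - a x p"
    by (elim aff.cohomologous_trivialE) blast
  have o: "open (N x)" for x using N by (simp add: point_cover_def)
  show "(form.trivial_cocycle, X) \<in> cohomologous (foliated_form A S)" unfolding X
  proof (rule form.cohomologous_trivialI[OF proj_form_cocycle[OF c] N(1,2)])
    show "proj_form A S (a x) \<in> foliated_form A S (N x)" for x
      by (rule proj_form_leafwise_affine[OF o N(3)])
    fix x y p assume p: "p \<in> N x" "p \<in> N y"
    let ?N = "N x \<inter> N y"
    have sm: "smooth_fun A ?N (a x)" "smooth_fun A ?N (a y)"
      using aff.restrict[OF N(3), of ?N] o by (auto intro!: smooth_fun_if_leafwise_affine)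
    have "proj_form A S (t x y) p = proj_form A S (\<lambda>q. a y q - a x q) p"
      using p o a by (intro proj_form_cong[of ?N]) auto
    also have "\<dots> = proj_form A S (a y) p - proj_form A S (a x) p"
      using p by (intro proj_form_diff[OF sm(2,1)]) simp
    finally show "proj_form A S (t x y) p = proj_form A S (a y) p - proj_form A S (a x) p" .
  qed
qed

text \<open>
  A primitive of an element of the kernel consists of leafwise affine functions whose projections
  agree on overlaps; they glue to a global foliated form whose connecting class is the given one.
\<close>

lemma H1_map_inclusion_kernel:
  assumes cv: "connecting_vanishes A S" and C: "C \<in> H1 (foliated_fun A S)"
    and C0: "H1_map (leafwise_affine A S) id C = H1_zero (leafwise_affine A S)"
  shows "C = H1_zero (foliated_fun A S)"
proof -
  obtain V s where c: "(V, s) \<in> cocycles1 (foliated_fun A S)"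
    and C_eq: "C = cohomologous (foliated_fun A S) `` {(V, s)}"
    using C by (auto simp: H1_def quotient_def)
  have "(V, s) \<in> C" using fol.cohomologous_refl[OF c] C_eq by simp
  moreover have "((V, s), (V, s)) \<in> cohomologous (leafwise_affine A S)"
    using aff.cohomologous_refl c cocycles1_foliated_subset by blast
  ultimately have "(V, s) \<in> H1_map (leafwise_affine A S) id C"
    unfolding H1_map_id by blast
  then have "(aff.trivial_cocycle, (V, s)) \<in> cohomologous (leafwise_affine A S)"
    by (simp add: C0 aff.H1_zero_eq)
  then obtain N a where N: "point_cover N" "\<And>x. N x \<subseteq> V x" "\<And>x. a x \<in> leafwise_affine A S (N x)"
    and a: "\<And>x y p. p \<in> N x \<Longrightarrow> p \<in> N y \<Longrightarrow> s x y p = a y p - a x p"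
    by (elim aff.cohomologous_trivialE) blast
  have o: "open (N x)" and mem: "x \<in> N x" for x using N by (auto simp: point_cover_def)
  have s: "s x y \<in> foliated_fun A S (V x \<inter> V y)" for x y
    using c by (auto simp: cocycles1_def)
  \<comment> \<open>A difference of two leafwise affine functions is in general only leafwise
    affine. Here it coincides with \<open>s x y\<close> and is therefore foliated, so its projection
    vanishes and the projections of the \<open>a x\<close> agree on overlaps.\<close>
  have diff: "(\<lambda>p. a y p - a x p) \<in> foliated_fun A S (N x \<inter> N y)" for x y
  proof (rule fol.cong[OF fol.restrict[OF s[of x y]]])
    show "N x \<inter> N y \<subseteq> V x \<inter> V y" using N(2) by blast
    show "s x y p = a y p - a x p" if "p \<in> N x \<inter> N y" for p using a that by blast
  qed (simp_all add: o open_Int)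
  define \<omega> where "\<omega> = (\<lambda>p. proj_form A S (a p) p)"
  have \<omega>: "proj_form A S (a x) p = \<omega> p" if p: "p \<in> N x" for x p
  proof -
    let ?N = "N x \<inter> N p"
    have sm: "smooth_fun A ?N (a x)" "smooth_fun A ?N (a p)"
      using aff.restrict[OF N(3), of ?N] o by (auto intro!: smooth_fun_if_leafwise_affine)
    have "proj_form A S (a p) p - proj_form A S (a x) p = proj_form A S (\<lambda>q. a p q - a x q) p"
      using p mem by (intro proj_form_diff[OF sm(2,1), symmetric]) simp
    also have "\<dots> = 0" using p mem by (intro proj_form_foliated[OF diff]) simp
    finally show ?thesis by (simp add: \<omega>_def)
  qed
  have "\<omega> \<in> foliated_form A S UNIV"
  proof (rule form.glue)
    fix p
    show "\<exists>M g. open M \<and> p \<in> M \<and> M \<subseteq> UNIV \<and> g \<in> foliated_form A S M \<and> (\<forall>q\<in>M. \<omega> q = g q)"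
      using o mem \<omega> proj_form_leafwise_affine[OF o N(3)]
      by (intro exI[of _ "N p"] exI[of _ "proj_form A S (a p)"]) auto
  qed simp
  then have conn: "connecting A S \<omega> = H1_zero (foliated_fun A S)"
    using cv by (simp add: connecting_vanishes_def)
  have c': "(N, \<lambda>x y p. a y p - a x p) \<in> cocycles1 (foliated_fun A S)"
    using N(1) diff by (auto simp: cocycles1_def)
  \<comment> \<open>\<open>N\<close> and \<open>a\<close> are one of the systems of local lifts of
    \<open>\<omega>\<close> from which \<open>connecting\<close> is built.\<close>
  have "(N, \<lambda>x y p. a y p - a x p) \<in> connecting A S \<omega>"
    unfolding connecting_def
    by (rule ImageI[OF fol.cohomologous_refl[OF c']]) (use N \<omega> in blast)
  then have "(fol.trivial_cocycle, (N, \<lambda>x y p. a y p - a x p)) \<in> cohomologous (foliated_fun A S)"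
    unfolding conn fol.H1_zero_eq by blast
  \<comment> \<open>The two cocycles are equal on the finer covering \<open>N\<close>, so the zero
    cochain is a primitive of their difference.\<close>
  moreover have "((N, \<lambda>x y p. a y p - a x p), (V, s)) \<in> cohomologous (foliated_fun A S)"
    by (rule cohomologousI[OF c' c N(1) order_refl N(2), of "\<lambda>x p. 0"]) (simp_all add: o fol.zero a)
  ultimately have "(fol.trivial_cocycle, (V, s)) \<in> cohomologous (foliated_fun A S)"
    by (rule fol.cohomologous_trans)
  then show ?thesis
    unfolding C_eq fol.H1_zero_eq
    using equiv_class_eq[OF fol.equiv_cohomologous] by metis
qed

section \<open>Global Lagrangians and the total obstruction\<close>

lemma globally_lagrange_iff_total_obstruction:
  assumes U: "\<And>\<alpha>. \<alpha> \<in> I \<Longrightarrow> open (U \<alpha>)" "(\<Union>\<alpha>\<in>I. U \<alpha>) = UNIV"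
    and sm: "\<And>\<alpha>. \<alpha> \<in> I \<Longrightarrow> smooth_fun A (U \<alpha>) (L \<alpha>)"
    and aff: "\<And>\<alpha> \<beta>. \<alpha> \<in> I \<Longrightarrow> \<beta> \<in> I \<Longrightarrow> (\<lambda>p. L \<beta> p - L \<alpha> p) \<in> leafwise_affine A S (U \<alpha> \<inter> U \<beta>)"
  shows "globally_lagrange A S I U L
    \<longleftrightarrow> total_obstruction A S I U L = H1_zero (leafwise_affine A S)"
proof
  let ?X = "{(\<lambda>x. U (\<tau> x), \<lambda>x y p. L (\<tau> y) p - L (\<tau> x) p) | \<tau>. \<forall>x. \<tau> x \<in> I \<and> x \<in> U (\<tau> x)}"
  have total: "total_obstruction A S I U L = cohomologous (leafwise_affine A S) `` ?X"
    by (simp add: total_obstruction_def cocycle_class_def)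
  have cover: "point_cover (\<lambda>x. U (\<tau> x))" if "\<forall>x. \<tau> x \<in> I \<and> x \<in> U (\<tau> x)" for \<tau>
    using that U by (simp add: point_cover_def)
  have cocycle: "(\<lambda>x. U (\<tau> x), \<lambda>x y p. L (\<tau> y) p - L (\<tau> x) p) \<in> cocycles1 (leafwise_affine A S)"
    if "\<forall>x. \<tau> x \<in> I \<and> x \<in> U (\<tau> x)" for \<tau>
    using that cover[OF that] aff by (simp add: cocycles1_def)
  show "total_obstruction A S I U L = H1_zero (leafwise_affine A S)"
    if gl: "globally_lagrange A S I U L"
  proof -
    obtain K where K: "\<And>\<alpha>. \<alpha> \<in> I \<Longrightarrow> (\<lambda>p. K p - L \<alpha> p) \<in> leafwise_affine A S (U \<alpha>)"
      using gl by (auto simp: globally_lagrange_def)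
    \<comment> \<open>A refinement map exists because the \<open>U \<alpha>\<close> cover, so the
      set \<open>?X\<close> of pullbacks is nonempty.\<close>
    obtain \<tau> where \<tau>: "\<forall>x. \<tau> x \<in> I \<and> x \<in> U (\<tau> x)" using U(2) by (metis UN_E UNIV_I)
    show ?thesis unfolding total
    proof (rule aff.Image_eq_H1_zeroI)
      show "(\<lambda>x. U (\<tau> x), \<lambda>x y p. L (\<tau> y) p - L (\<tau> x) p) \<in> ?X" using \<tau> by blast
      fix X assume "X \<in> ?X"
      then obtain \<sigma> where X: "X = (\<lambda>x. U (\<sigma> x), \<lambda>x y p. L (\<sigma> y) p - L (\<sigma> x) p)"
        and \<sigma>: "\<forall>x. \<sigma> x \<in> I \<and> x \<in> U (\<sigma> x)" by blast
      show "(aff.trivial_cocycle, X) \<in> cohomologous (leafwise_affine A S)" unfolding X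
      proof (rule aff.cohomologous_trivialI[OF cocycle[OF \<sigma>] cover[OF \<sigma>] order_refl])
        show "(\<lambda>p. - (K p - L (\<sigma> x) p)) \<in> leafwise_affine A S (U (\<sigma> x))" for x
          using aff.minus K \<sigma> U by blast
      qed simp
    qed
  qed
  show "globally_lagrange A S I U L"
    if eq: "total_obstruction A S I U L = H1_zero (leafwise_affine A S)"
  proof -
    \<comment> \<open>Membership of the trivial cocycle in the saturated set yields some refinement
      map whose pullback is cohomologous to it.\<close>
    have "aff.trivial_cocycle \<in> total_obstruction A S I U L"
      using aff.cohomologous_refl[OF aff.trivial_cocycle] by (simp add: eq aff.H1_zero_eq)
    then obtain \<tau> where \<tau>: "\<forall>x. \<tau> x \<in> I \<and> x \<in> U (\<tau> x)"
      and "((\<lambda>x. U (\<tau> x), \<lambda>x y p. L (\<tau> y) p - L (\<tau> x) p), aff.trivial_cocycle)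
        \<in> cohomologous (leafwise_affine A S)"
      unfolding total by blast
    from aff.cohomologous_sym[OF this(2)]
    obtain N a where N: "point_cover N" "\<And>x. N x \<subseteq> U (\<tau> x)" "\<And>x. a x \<in> leafwise_affine A S (N x)"
      and a: "\<And>x y p. p \<in> N x \<Longrightarrow> p \<in> N y \<Longrightarrow> L (\<tau> y) p - L (\<tau> x) p = a y p - a x p"
      by (elim aff.cohomologous_trivialE) blast
    have o: "open (N x)" and mem: "x \<in> N x" for x using N by (auto simp: point_cover_def)
    define K where "K = (\<lambda>p. L (\<tau> p) p - a p p)"
    have K: "K p = L (\<tau> x) p - a x p" if "p \<in> N x" for x p
      using a[OF mem that] by (simp add: K_def algebra_simps)
    have "K \<in> Collect (smooth_fun A UNIV)"
    proof (rule smooth.glue)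
      fix p
      have "L (\<tau> p) \<in> Collect (smooth_fun A (N p))"
        using smooth.restrict[of "L (\<tau> p)" "U (\<tau> p)" "N p"] sm \<tau> N o by simp
      then have "(\<lambda>q. L (\<tau> p) q - a p q) \<in> Collect (smooth_fun A (N p))"
        using smooth_fun_if_leafwise_affine[OF N(3)] o by (intro smooth.diff) auto
      then show "\<exists>M g. open M \<and> p \<in> M \<and> M \<subseteq> UNIV \<and> g \<in> Collect (smooth_fun A M) \<and> (\<forall>q\<in>M. K q = g q)"
        using o mem K by (intro exI[of _ "N p"] exI[of _ "\<lambda>q. L (\<tau> p) q - a p q"]) auto
    qed simp
    \<comment> \<open>The index \<open>\<alpha>\<close> need not be a value of
      \<open>\<tau>\<close>. Near \<open>p\<close> the difference is
      \<open>(L (\<tau> p) - L \<alpha>) - a p\<close>, and both terms are leafwise affine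
      there.\<close>
    moreover have "(\<lambda>p. K p - L \<alpha> p) \<in> leafwise_affine A S (U \<alpha>)" if \<alpha>: "\<alpha> \<in> I" for \<alpha>
    proof (rule aff.glue[OF U(1)[OF \<alpha>]])
      fix p assume p: "p \<in> U \<alpha>"
      let ?M = "N p \<inter> U \<alpha>"
      have M: "open ?M" using o U \<alpha> by blast
      have "(\<lambda>q. L (\<tau> p) q - L \<alpha> q) \<in> leafwise_affine A S ?M"
        by (rule aff.restrict[OF aff[of \<alpha> "\<tau> p"] _ M]) (use \<alpha> \<tau> N in auto)
      moreover have "a p \<in> leafwise_affine A S ?M"
        by (rule aff.restrict[OF N(3) _ M]) simp
      ultimately have "(\<lambda>q. (L (\<tau> p) q - L \<alpha> q) - a p q) \<in> leafwise_affine A S ?M"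
        by (rule aff.diff[OF M])
      then show "\<exists>M g. open M \<and> p \<in> M \<and> M \<subseteq> U \<alpha> \<and> g \<in> leafwise_affine A S M
          \<and> (\<forall>q\<in>M. K q - L \<alpha> q = g q)"
        using M mem p K
        by (intro exI[of _ ?M] exI[of _ "\<lambda>q. (L (\<tau> p) q - L \<alpha> q) - a p q"]) auto
    qed
    ultimately show ?thesis by (auto simp: globally_lagrange_def)
  qed
qed

end

theorem proposition2p3:
  fixes A :: "('m::{t2_space, second_countable_topology}, 'n::finite) chart set"
    and S :: "('m, 'n) endo_field"
    and g :: "('m, 'n) bilin_field"
    and I :: "'i set" and U :: "'i \<Rightarrow> 'm set" and L :: "'i \<Rightarrow> 'm \<Rightarrow> real"
  assumes "locally_lagrange_space A S g I U L"
  shows "(connecting_vanishes A S \<longrightarrow>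
           (globally_lagrange A S I U L \<longleftrightarrow>
              first_obstruction A S I U L = H1_zero (foliated_form A S) \<and>
              second_obstruction_exists A S I U L \<and>
              second_obstruction A S I U L = H1_zero (foliated_fun A S)))
         \<and> (globally_lagrange A S I U L \<longleftrightarrow>
              first_obstruction A S I U L = H1_zero (foliated_form A S) \<and>
              (\<exists>C. is_second_obstruction A S I U L C \<and> C = H1_zero (foliated_fun A S)))"
proof -
  let ?\<Phi> = "foliated_fun A S" and ?A0 = "leafwise_affine A S"
  interpret tangent_structure A S
    by unfold_locales (use assms in \<open>simp add: locally_lagrange_space_def\<close>)
  have U: "\<And>\<alpha>. \<alpha> \<in> I \<Longrightarrow> open (U \<alpha>)" "(\<Union>\<alpha>\<in>I. U \<alpha>) = UNIV"
    and reg: "\<And>\<alpha>. \<alpha> \<in> I \<Longrightarrow> regular_lagrangian A S (U \<alpha>) (L \<alpha>)"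
    and g: "\<And>\<alpha> c p. \<alpha> \<in> I \<Longrightarrow> adapted A S c \<Longrightarrow> p \<in> dom_chart c \<Longrightarrow> p \<in> U \<alpha> \<Longrightarrow>
      transversal_components g p c = hess (L \<alpha>) p c"
    using assms unfolding locally_lagrange_space_def by blast+
  have sm: "smooth_fun A (U \<alpha>) (L \<alpha>)" if "\<alpha> \<in> I" for \<alpha>
    using reg[OF that] by (simp add: regular_lagrangian_def)
  have affine: "(\<lambda>p. L \<beta> p - L \<alpha> p) \<in> ?A0 (U \<alpha> \<inter> U \<beta>)" if "\<alpha> \<in> I" "\<beta> \<in> I" for \<alpha> \<beta>
  proof (rule leafwise_affine_diff_if_hess_eq)
    show o: "open (U \<alpha> \<inter> U \<beta>)" using U that by blast
    show "smooth_fun A (U \<alpha> \<inter> U \<beta>) (L \<beta>)" "smooth_fun A (U \<alpha> \<inter> U \<beta>) (L \<alpha>)"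
      using smooth.restrict[of "L \<beta>" "U \<beta>", OF _ Int_lower2 o]
        smooth.restrict[of "L \<alpha>" "U \<alpha>", OF _ Int_lower1 o] sm that by auto
    show "hess (L \<beta>) p c = hess (L \<alpha>) p c"
      if "adapted A S c" "p \<in> dom_chart c" "p \<in> U \<alpha> \<inter> U \<beta>" for c p
      \<comment> \<open>Both Hessians are the transversal components of the one global tensor
        \<open>g\<close>.\<close>
      using g \<open>\<alpha> \<in> I\<close> \<open>\<beta> \<in> I\<close> that by (metis IntE)
  qed
  have total: "globally_lagrange A S I U L \<longleftrightarrow> total_obstruction A S I U L = H1_zero ?A0"
    by (rule globally_lagrange_iff_total_obstruction[OF U sm affine])
  have first: "first_obstruction A S I U L = H1_zero (foliated_form A S)"
    if "total_obstruction A S I U L = H1_zero ?A0"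
    using that H1_map_proj_form_zero by (simp add: first_obstruction_def)
  \<comment> \<open>The inclusion sends zero to zero, so for the zero class the last clause of
    \<open>is_second_obstruction\<close> says that the total obstruction vanishes; the clause on the
    first obstruction is then a consequence.\<close>
  have zero: "globally_lagrange A S I U L \<longleftrightarrow> is_second_obstruction A S I U L (H1_zero ?\<Phi>)"
    unfolding total is_second_obstruction_def
    using first fol.H1_zero_in_H1 H1_map_inclusion_zero by auto
  \<comment> \<open>With a global Lagrangian the total obstruction is zero, so every second
    obstruction lies in the kernel of the inclusion on cohomology.\<close>
  have unique: "C = H1_zero ?\<Phi>"
    if "connecting_vanishes A S" "globally_lagrange A S I U L" "is_second_obstruction A S I U L C" for C
    using that H1_map_inclusion_kernel by (simp add: total is_second_obstruction_def)
  have first': "first_obstruction A S I U L = H1_zero (foliated_form A S)"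
    if "is_second_obstruction A S I U L C" for C
    using that by (simp add: is_second_obstruction_def)
  have "globally_lagrange A S I U L \<longleftrightarrow>
      second_obstruction_exists A S I U L \<and> second_obstruction A S I U L = H1_zero ?\<Phi>"
    if cv: "connecting_vanishes A S"
  proof
    assume gl: "globally_lagrange A S I U L"
    then have "is_second_obstruction A S I U L (H1_zero ?\<Phi>)" using zero by simp
    then show "second_obstruction_exists A S I U L \<and> second_obstruction A S I U L = H1_zero ?\<Phi>"
      using unique[OF cv gl] unfolding second_obstruction_exists_def second_obstruction_def
      by (intro conjI ex1I the_equality)
  next
    assume "second_obstruction_exists A S I U L \<and> second_obstruction A S I U L = H1_zero ?\<Phi>"
    \<comment> \<open>Unique existence is what turns the description in
      \<open>second_obstruction\<close> into an actual second obstruction, here the zero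
      class.\<close>
    then have "is_second_obstruction A S I U L (H1_zero ?\<Phi>)"
      using theI'[of "is_second_obstruction A S I U L"]
      by (simp add: second_obstruction_exists_def second_obstruction_def)
    then show "globally_lagrange A S I U L" using zero by simp
  qed
  then show ?thesis using zero first' by blast
qed

end
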